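(* Let $G=\mathbb{Z}/p\mathbb{Z}$ for a prime number $p$. Let $V$ be a faithful, finite-dimensional representation of $G$ over a field $\mathbf{k}$ with $\operatorname{char}\mathbf{k}\neq p$, in which exactly two distinct nontrivial characters of $G$ occur. Then, unless these two characters are inverses of each other, $$\beta_{\mathrm{field}}(G,V)\leq\frac{p+3}{2}.$$
   Context: $\mathbf{k}[V]$ is the ring of polynomial functions on $V$, $\mathbf{k}(V)$ its fraction field, with $G$ acting by $(gf)(v)=f(g^{-1}v)$; $\mathbf{k}[V]^G$, $\mathbf{k}(V)^G$ are the invariants, and $\mathbf{k}[V]^G_{\leq d}$ is the space of invariant polynomials of degree at most $d$. $\beta_{\mathrm{field}}(G,V)$ is the least natural number $d$ such that $\mathbf{k}[V]^G_{\leq d}$ generates $\mathbf{k}(V)^G$ as a field extension of $\mathbf{k}$. The characters occurring in $V$ are those occurring in $\mathbf{K}\otimes_{\mathbf{k}}V$, where $\mathbf{K}\supseteq\mathbf{k}$ is an extension field containing the $p$th roots of unity. *)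

theory Defs
  imports
    "HOL-Library.Poly_Mapping"
    "HOL-Computational_Algebra.Fraction_Field"
    "HOL-Algebra.Algebra"
    "HOL-Algebra.Algebraic_Closure_Type"
begin

text \<open>
  Polynomials in the indeterminates \<open>X\<^sub>0, X\<^sub>1, \<dots>\<close> over a field: a monomial is its finitely supported
  exponent vector, a polynomial is a finitely supported family of coefficients indexed by monomials,
  and multiplication is convolution.
\<close>

type_synonym 'a mpoly = "(nat \<Rightarrow>\<^sub>0 nat) \<Rightarrow>\<^sub>0 'a"

definition Const :: "'a \<Rightarrow> 'a::field mpoly" where
  "Const c = Poly_Mapping.single 0 c"

definition Var :: "nat \<Rightarrow> 'a::field mpoly" where
  "Var i = Poly_Mapping.single (Poly_Mapping.single i 1) 1"

definition mpolys :: "nat \<Rightarrow> 'a::field mpoly set" where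
  "mpolys n = {f. \<forall>m\<in>Poly_Mapping.keys f. Poly_Mapping.keys m \<subseteq> {..<n}}"

definition total_degree_le :: "nat \<Rightarrow> 'a::field mpoly \<Rightarrow> bool" where
  "total_degree_le d f \<longleftrightarrow>
     (\<forall>m\<in>Poly_Mapping.keys f. (\<Sum>i\<in>Poly_Mapping.keys m. Poly_Mapping.lookup m i) \<le> d)"

definition psubst :: "(nat \<Rightarrow> 'a mpoly) \<Rightarrow> 'a::field mpoly \<Rightarrow> 'a mpoly" where
  "psubst s f =
     (\<Sum>m\<in>Poly_Mapping.keys f. Const (Poly_Mapping.lookup f m) *
        (\<Prod>i\<in>Poly_Mapping.keys m. s i ^ Poly_Mapping.lookup m i))"

definition rat_funs :: "nat \<Rightarrow> 'a::field mpoly fract set" where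
  "rat_funs n = {Fract f h | f h. f \<in> mpolys n \<and> h \<in> mpolys n \<and> h \<noteq> 0}"

text \<open>
  A finite-dimensional representation \<open>\<rho>\<close> of a group \<open>G\<close> on the vector space \<open>'v\<close> over \<open>'k\<close>, together
  with a basis \<open>b 0, \<dots>, b (n - 1)\<close>.  The basis only serves to identify the ring of polynomial
  functions \<open>k[V]\<close> (as usual, the symmetric algebra on the dual of \<open>V\<close>, also when \<open>k\<close> is finite)
  with the polynomial ring in the coordinate functions \<open>X\<^sub>0, \<dots>, X\<^sub>n\<^sub>-\<^sub>1\<close> dual to \<open>b\<close>.
\<close>

locale finite_dim_rep =
  group G + finite_dimensional_vector_space scale "b ` {..<n}"
  for G :: "('g, 'm) monoid_scheme" (structure)
    and scale :: "'k::field \<Rightarrow> 'v::ab_group_add \<Rightarrow> 'v"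
    and \<rho> :: "'g \<Rightarrow> 'v \<Rightarrow> 'v"
    and b :: "nat \<Rightarrow> 'v"
    and n :: nat +
  assumes basis_inj: "inj_on b {..<n}"
    and rep_linear: "g \<in> carrier G \<Longrightarrow> Vector_Spaces.linear scale scale (\<rho> g)"
    and rep_one: "\<rho> \<one> = id"
    and rep_mult: "g \<in> carrier G \<Longrightarrow> h \<in> carrier G \<Longrightarrow> \<rho> (g \<otimes> h) = \<rho> g \<circ> \<rho> h"
begin

definition faithful :: bool where
  "faithful \<longleftrightarrow> inj_on \<rho> (carrier G)"

definition rep_entry :: "'g \<Rightarrow> nat \<Rightarrow> nat \<Rightarrow> 'k" where
  "rep_entry g i j = representation (b ` {..<n}) (\<rho> g (b j)) (b i)"

text \<open>
  \<open>(g f)(v) = f (g\<inverse> v)\<close>: the coordinate function \<open>X\<^sub>i\<close> is sent to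
  \<open>v \<mapsto> X\<^sub>i (g\<inverse> v)\<close>, whose coefficient at \<open>X\<^sub>j\<close> is the \<open>i\<close>-th coordinate of \<open>g\<inverse> (b j)\<close>.
\<close>

definition act :: "'g \<Rightarrow> 'k mpoly \<Rightarrow> 'k mpoly" where
  "act g = psubst (\<lambda>i. \<Sum>j<n. Const (rep_entry (inv g) i j) * Var j)"

definition act_fract :: "'g \<Rightarrow> 'k mpoly fract \<Rightarrow> 'k mpoly fract" where
  "act_fract g q = (THE r. \<forall>f\<in>mpolys n. \<forall>h\<in>mpolys n.
     h \<noteq> 0 \<longrightarrow> q = Fract f h \<longrightarrow> r = Fract (act g f) (act g h))"

definition invariant_polys :: "'k mpoly set" where
  "invariant_polys = {f \<in> mpolys n. \<forall>g\<in>carrier G. act g f = f}"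

definition invariant_rat_funs :: "'k mpoly fract set" where
  "invariant_rat_funs = {q \<in> rat_funs n. \<forall>g\<in>carrier G. act_fract g q = q}"

definition beta_field :: nat where
  "beta_field = (LEAST d.
     generate_field ring_of_type_algebra
       (((\<lambda>c. Fract (Const c) 1) ` UNIV) \<union>
        ((\<lambda>f. Fract f 1) ` {f \<in> invariant_polys. total_degree_le d f}))
     = invariant_rat_funs)"

text \<open>
  Let \<open>\<iota>\<close> embed \<open>'k\<close> into an extension field \<open>'e\<close>.  A character \<open>\<chi>\<close> with values in \<open>'e\<close> occurs in
  \<open>'e \<otimes> V\<close> if some nonzero vector \<open>\<Sum>\<^sub>i w\<^sub>i \<otimes> b i\<close> is scaled by \<open>\<chi> g\<close> under every \<open>g\<close>.  Characters are
  taken to be extensional so that they are determined by their values on \<open>G\<close>.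
\<close>

definition characters_occurring :: "('k \<Rightarrow> 'e::field) \<Rightarrow> ('g \<Rightarrow> 'e) set" where
  "characters_occurring \<iota> =
     {\<chi> \<in> hom G (mult_of (ring_of_type_algebra :: 'e ring)) \<inter> extensional (carrier G).
        \<exists>w :: nat \<Rightarrow> 'e. (\<exists>i<n. w i \<noteq> 0) \<and>
          (\<forall>g\<in>carrier G. \<forall>i<n. (\<Sum>j<n. \<iota> (rep_entry g i j) * w j) = \<chi> g * w i)}"

definition nontrivial_characters_occurring :: "('k \<Rightarrow> 'e::field) \<Rightarrow> ('g \<Rightarrow> 'e) set" where
  "nontrivial_characters_occurring \<iota> = characters_occurring \<iota> - {\<lambda>g\<in>carrier G. 1}"

end

end

theory Submission
  imports Defs
begin

text \<open>
  Over an extension containing the \<open>p\<close>-th roots of unity, a generator of the group satisfies a cubic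
  equation with roots \<open>1, \<zeta>\<^sub>1, \<zeta>\<^sub>2\<close>. Its coefficients are determined by linear equations over the ground
  field, so \<open>\<zeta>\<^sub>1 \<zeta>\<^sub>2\<close> lies in the ground field; being different from \<open>1\<close>, it is a primitive \<open>p\<close>-th
  root of unity. Hence the ground field contains all \<open>p\<close>-th roots of unity, and the coordinate
  functions are sums of eigenforms over it.

  A monomial in eigenforms is invariant iff its pair \<open>(i, j)\<close> of degrees in the two nontrivial
  eigenspaces lies in a lattice \<open>j \<equiv> e i (mod p)\<close>, where \<open>2 \<le> e \<le> p - 2\<close> as the characters are neither
  equal nor inverse to each other. This lattice has a basis of two vectors with nonnegative entries
  and coordinate sums at most \<open>(p + 3) / 2\<close>, found among consecutive boundary points of the convex
  hull of its nonzero points in the positive quadrant. The corresponding invariant monomials,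
  together with those in which one factor is exchanged for another form of the same eigenspace,
  generate all invariant monomials as a field; averaging over the group then gives all invariant
  polynomials, and norms of denominators all invariant rational functions.
\<close>

section \<open>Short bases of planar lattices\<close>

text \<open>The lattice \<open>j \<equiv> e i\<close> has index \<open>p\<close>, so two of its
  vectors with determinant \<open>p\<close> up to sign form a basis. Candidates are neighbouring
  lattice points near the axes; which pair is short enough depends on whether \<open>e\<close> lies
  below \<open>p / 2\<close>, above \<open>2 p / 3\<close>, or in between.\<close>

lemma small_lattice_basis:
  fixes p e :: nat
  assumes "odd p" "2 \<le> e" "e + 2 \<le> p"
  obtains a b c d :: nat
  where "a + b \<le> (p + 3) div 2" "c + d \<le> (p + 3) div 2"
    "int p dvd int b - int e * int a" "int p dvd int d - int e * int c"
    "\<bar>int a * int d - int b * int c\<bar> = int p"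
proof -
  have half: "x \<le> (p + 3) div 2 \<longleftrightarrow> 2 * int x \<le> int p + 3" for x :: nat
    using \<open>odd p\<close> by presburger
  have eucl: "\<exists>q r. (m::nat) = q * k + r \<and> r < k" if "0 < k" for m k
    using that by (metis div_mult_mod_eq mod_less_divisor)
  \<comment> \<open>Division with the quotient rounded up: \<open>r\<close> is the excess of
    \<open>q * k\<close> over \<open>m\<close>. It comes from ordinary division of
    \<open>m + (k - 1)\<close>.\<close>
  have eucl_ceil: "\<exists>q r. (m::nat) + r = q * k \<and> r < k" if k: "0 < k" for m k
  proof -
    obtain q r where "m + (k - 1) = q * k + r" "r < k" using eucl[OF k] by blast
    then show ?thesis using k by (intro exI[of _ q] exI[of _ "k - 1 - r"]) auto
  qed
  have "2 * e \<le> p + 1 \<or> p + 3 \<le> 2 * e" using \<open>odd p\<close> by presburger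
  then consider (A) "2 * e \<le> p + 1" | (BC) "p + 3 \<le> 2 * e" by blast
  then show thesis
  proof cases
    case A
    \<comment> \<open>The basis is \<open>(1, e)\<close> and
      \<open>(c, r) = c (1, e) - (0, p)\<close>, with \<open>c\<close> least such that the second
      entry is nonnegative.\<close>
    obtain c r where c: "p + r = c * e" "r < e" using eucl_ceil[of e p] assms by auto
    have "c \<noteq> 0" "c \<noteq> 1" using c assms by (cases "c = 0", auto)
    hence c2: "2 \<le> c" by simp
    have pc: "int p = int c * int e - int r" using c(1) by (simp flip: of_nat_mult of_nat_add)
    \<comment> \<open>From \<open>r \<le> e - 1\<close> the slack is at least
      \<open>(c - 3) (e - 2)\<close>. This is useless for \<open>c = 2\<close>, but there
      \<open>2 e \<le> p + 1\<close> forces \<open>r \<le> 1\<close>.\<close>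
    have deg: "2 * int (c + r) \<le> int p + 3"
    proof (cases "c = 2")
      case True then show ?thesis using pc A assms(2) by auto
    next
      case False
      hence "0 \<le> (int c - 3) * (int e - 2)" using c2 assms by simp
      then show ?thesis using pc c(2) by (simp add: algebra_simps)
    qed
    show thesis
    proof (rule that[of 1 e c r])
      show "1 + e \<le> (p + 3) div 2" "c + r \<le> (p + 3) div 2" using A deg half by auto
      show "int p dvd int r - int e * int c" unfolding pc
        by (rule dvdI[of _ _ "-1"]) (simp add: algebra_simps)
      show "\<bar>int 1 * int r - int e * int c\<bar> = int p" using pc by (simp add: algebra_simps)
    qed auto
  next
    case BC
    \<comment> \<open>Now \<open>j \<equiv> - e' i\<close>, so the points
      \<open>(m, p - m e')\<close> descend along a line. The last two with nonnegative entries are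
      \<open>(q - 1, s + e')\<close> and \<open>(q, s)\<close>.\<close>
    define e' where "e' = p - e"
    have e': "int e = int p - int e'" "2 \<le> e'" "2 * e' + 3 \<le> p" using assms BC unfolding e'_def by auto
    obtain q s where q: "p = q * e' + s" "s < e'" using eucl[of e' p] e' by auto
    have "q \<noteq> 0" "q \<noteq> 1" using q e' by (cases "q = 0", auto)
    hence q2: "2 \<le> q" by simp
    have q1: "int (q - 1) = int q - 1" using q2 by simp
    have pq: "int p = int q * int e' + int s" using q(1) by simp
    have eq: "int e = int q * int e' + int s - int e'" using e' pq by simp
    show thesis
    proof (cases "q = 2")
      case True
      hence ps: "int p = 2 * int e' + int s" and s3: "3 \<le> s" using pq e' q by auto
      \<comment> \<open>For \<open>q = 2\<close> the point \<open>(1, s + e') = (1, e)\<close> is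
        too large. It is replaced by \<open>(2 t + 1, w) = (1, e) + t (2, s) - (0, p)\<close>, with
        \<open>t\<close> least such that the second entry is nonnegative.\<close>
      obtain t w where t: "e' + w = t * s" "w < s" using eucl_ceil[of s e'] s3 by auto
      have "t \<noteq> 0" "t \<noteq> 1" using t q s3 by (cases "t = 0", auto)
      hence t2: "2 \<le> t" by simp
      have et: "int e' = int t * int s - int w" using t(1) by (simp flip: of_nat_mult of_nat_add)
      have ee: "int e = int e' + int s" and ww: "int w = int t * int s - int e'" using e' ps et by auto
      \<comment> \<open>By \<open>w \<le> s - 1\<close> the slack in the degree bound is at least
        \<open>(2 t - 3) (s - 2) - 1\<close>; hence the product has to be at least 1, not just
        nonnegative.\<close>
      have "1 * 1 \<le> (2 * int t - 3) * (int s - 2)" by (rule mult_mono) (use t2 s3 in auto)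
      hence deg: "2 * int (2 * t + 1 + w) \<le> int p + 3" using ps et t(2) by (simp add: algebra_simps)
      show thesis
      proof (rule that[of 2 s "2 * t + 1" w])
        show "2 + s \<le> (p + 3) div 2" using half ps q by auto
        show "2 * t + 1 + w \<le> (p + 3) div 2" using half deg by blast
        show "int p dvd int s - int e * int 2"
          by (rule dvdI[of _ _ "-1"]) (use e' ps in \<open>simp add: algebra_simps\<close>)
        show "int p dvd int w - int e * int (2 * t + 1)"
          by (rule dvdI[of _ _ "-2 * int t - 1 + int t"]) (simp add: ee ww ps algebra_simps)
        show "\<bar>int 2 * int w - int s * int (2 * t + 1)\<bar> = int p"
          by (simp add: ww ps algebra_simps)
      qed
    next
      case False
      \<comment> \<open>By \<open>s \<le> e' - 1\<close> the slack for the larger of the two vectors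
        is at least this product.\<close>
      hence "0 \<le> (int q - 3) * (int e' - 2)" using q2 e' by simp
      hence deg: "2 * int (q - 1 + (s + e')) \<le> int p + 3" using pq q(2) q2 by (simp add: algebra_simps of_nat_diff)
      show thesis
      proof (rule that[of "q - 1" "s + e'" q s])
        show "q - 1 + (s + e') \<le> (p + 3) div 2" using half deg by blast
        then show "q + s \<le> (p + 3) div 2" using e' q2 by linarith
        show "int p dvd int (s + e') - int e * int (q - 1)"
          by (rule dvdI[of _ _ "- int q + 2"]) (simp only: q1 eq pq of_nat_add, simp add: algebra_simps)
        show "int p dvd int s - int e * int q"
          by (rule dvdI[of _ _ "1 - int q"]) (simp only: eq pq, simp add: algebra_simps)
        show "\<bar>int (q - 1) * int s - int (s + e') * int q\<bar> = int p"
        proof -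
          have "int (q - 1) * int s - int (s + e') * int q = - int p"
            unfolding q1 pq by (simp add: algebra_simps)
          then show ?thesis by simp
        qed
      qed
    qed
  qed
qed

text \<open>Cramer's rule: the numerators are determinants of pairs of lattice vectors, hence
  multiples of \<open>p\<close>, which is the denominator up to sign.\<close>

lemma lattice_coordinates:
  fixes a b c d i j e :: int and p :: nat
  assumes "0 < p" and "\<bar>a * d - b * c\<bar> = int p"
    and "int p dvd b - e * a" "int p dvd d - e * c" "int p dvd j - e * i"
  obtains x y where "i = x * a + y * c" "j = x * b + y * d"
proof -
  define D where "D = a * d - b * c"
  have "D \<noteq> 0" using assms(1,2) unfolding D_def by auto
  have D: "D dvd z" if "int p dvd z" for z using that assms(2) unfolding D_def[symmetric]
    by (metis abs_dvd_iff)
  have "int p dvd i * d - j * c"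
  proof -
    have "i * d - j * c = i * (d - e * c) - c * (j - e * i)" by (simp add: algebra_simps)
    thus ?thesis using assms by (metis dvd_diff dvd_mult)
  qed
  then obtain x where x: "i * d - j * c = D * x" using D by (meson dvdE)
  have "int p dvd j * a - i * b"
  proof -
    have "j * a - i * b = a * (j - e * i) - i * (b - e * a)" by (simp add: algebra_simps)
    thus ?thesis using assms by (metis dvd_diff dvd_mult)
  qed
  then obtain y where y: "j * a - i * b = D * y" using D by (meson dvdE)
  have "D * i = D * (x * a + y * c)" 
    using arg_cong2[OF x y, of "\<lambda>u v. u * a + v * c"] by (simp add: algebra_simps D_def)
  moreover have "D * j = D * (x * b + y * d)" 
    using arg_cong2[OF x y, of "\<lambda>u v. u * b + v * d"] by (simp add: algebra_simps D_def)
  ultimately show thesis using that[of x y] \<open>D \<noteq> 0\<close> by simp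
qed

section \<open>Polynomials and substitution\<close>

definition mon_subst :: "(nat \<Rightarrow> 'a mpoly) \<Rightarrow> (nat \<Rightarrow>\<^sub>0 nat) \<Rightarrow> 'a::field mpoly" where
  "mon_subst s m = (\<Prod>i\<in>Poly_Mapping.keys m. s i ^ Poly_Mapping.lookup m i)"

text \<open>Additional indices contribute exponent 0. A common index set allows monomials with
  different supports to be multiplied factor by factor.\<close>

lemma mon_subst_superset:
  assumes "finite A" "Poly_Mapping.keys m \<subseteq> A"
  shows "mon_subst s m = (\<Prod>i\<in>A. s i ^ Poly_Mapping.lookup m i)"
  unfolding mon_subst_def using assms
  by (intro prod.mono_neutral_left) (auto simp: in_keys_iff)

lemma mon_subst_zero [simp]: "mon_subst s 0 = 1"
  by (simp add: mon_subst_def)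

lemma mon_subst_add: "mon_subst s (m + m') = mon_subst s m * mon_subst s m'"
proof -
  let ?A = "Poly_Mapping.keys m \<union> Poly_Mapping.keys m'"
  have "finite ?A" "Poly_Mapping.keys (m + m') \<subseteq> ?A" by (simp_all add: keys_add)
  then show ?thesis
    using mon_subst_superset[of ?A m s] mon_subst_superset[of ?A m' s]
      mon_subst_superset[of ?A "m + m'" s]
    by (simp add: lookup_add power_add prod.distrib)
qed

lemma mon_subst_single: "mon_subst s (Poly_Mapping.single i k) = s i ^ k"
  by (cases "k = 0") (simp_all add: mon_subst_def)

lemma Const_0 [simp]: "Const 0 = 0"
  and Const_1 [simp]: "Const 1 = 1"
  and Const_add: "Const (a + b) = Const a + Const b"
  and Const_diff: "Const (a - b) = Const a - Const b"
  and Const_mult: "Const (a * b) = Const a * Const b"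
  by (simp_all add: Const_def single_add single_diff mult_single)

lemma Const_power: "Const (a ^ k) = Const a ^ k"
  by (induction k) (simp_all add: Const_mult)

lemma Const_sum: "Const (sum f A) = (\<Sum>x\<in>A. Const (f x))"
  by (induction A rule: infinite_finite_induct) (simp_all add: Const_add)

lemma Const_eq_0_iff [simp]: "Const a = 0 \<longleftrightarrow> a = 0"
  by (metis Const_0 Const_def inj_single injD lookup_single_eq)

lemma poly_mapping_sum_singles:
  "f = (\<Sum>m\<in>Poly_Mapping.keys f. Poly_Mapping.single m (Poly_Mapping.lookup f m))"
  by (rule poly_mapping_eqI) (simp add: lookup_sum lookup_single when_def in_keys_iff)

lemma psubst_alt:
  "psubst s f = (\<Sum>m\<in>Poly_Mapping.keys f. Const (Poly_Mapping.lookup f m) * mon_subst s m)"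
  by (simp add: psubst_def mon_subst_def)

lemma psubst_superset:
  assumes "finite A" "Poly_Mapping.keys f \<subseteq> A"
  shows "psubst s f = (\<Sum>m\<in>A. Const (Poly_Mapping.lookup f m) * mon_subst s m)"
  unfolding psubst_alt using assms
  by (intro sum.mono_neutral_left) (auto simp: in_keys_iff)

lemma psubst_single: "psubst s (Poly_Mapping.single m c) = Const c * mon_subst s m"
  by (cases "c = 0") (simp_all add: psubst_alt)

lemma psubst_0 [simp]: "psubst s 0 = 0"
  by (simp add: psubst_alt)

lemma psubst_Const [simp]: "psubst s (Const c) = Const c"
  unfolding Const_def psubst_single by (simp add: Const_def)

lemma psubst_1 [simp]: "psubst s 1 = 1"
  using psubst_Const[of s 1] by simp

lemma psubst_Var [simp]: "psubst s (Var i) = s i"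
  by (simp add: Var_def psubst_single mon_subst_single)

lemma psubst_add: "psubst s (f + g) = psubst s f + psubst s g"
proof -
  let ?A = "Poly_Mapping.keys f \<union> Poly_Mapping.keys g"
  have "finite ?A" "Poly_Mapping.keys (f + g) \<subseteq> ?A" by (simp_all add: keys_add)
  then show ?thesis
    using psubst_superset[of ?A f s] psubst_superset[of ?A g s] psubst_superset[of ?A "f + g" s]
    by (simp add: lookup_add Const_add algebra_simps sum.distrib)
qed

lemma psubst_sum: "psubst s (sum f A) = (\<Sum>x\<in>A. psubst s (f x))"
  by (induction A rule: infinite_finite_induct) (simp_all add: psubst_add)

lemma psubst_mult: "psubst s (f * g) = psubst s f * psubst s g"
proof -
  let ?m = "\<lambda>f m. Poly_Mapping.single m (Poly_Mapping.lookup f m)"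
  have "f * g = (\<Sum>m\<in>Poly_Mapping.keys f. ?m f m) * (\<Sum>m\<in>Poly_Mapping.keys g. ?m g m)"
    by (simp flip: poly_mapping_sum_singles)
  also have "psubst s \<dots> = (\<Sum>m\<in>Poly_Mapping.keys f. psubst s (?m f m)) *
      (\<Sum>m\<in>Poly_Mapping.keys g. psubst s (?m g m))"
    by (simp add: sum_product psubst_sum mult_single psubst_single Const_mult mon_subst_add
        mult_ac)
  also have "\<dots> = psubst s f * psubst s g"
    by (simp only: psubst_single psubst_alt[of s f] psubst_alt[of s g])
  finally show ?thesis .
qed

lemma psubst_power: "psubst s (f ^ k) = psubst s f ^ k"
  by (induction k) (simp_all add: psubst_mult)

lemma psubst_prod: "psubst s (prod f A) = (\<Prod>x\<in>A. psubst s (f x))"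
  by (induction A rule: infinite_finite_induct) (simp_all add: psubst_mult)

lemma mon_subst_Var: "mon_subst Var m = (Poly_Mapping.single m 1 :: 'a::field mpoly)"
proof -
  have "mon_subst Var (\<Sum>i\<in>A. Poly_Mapping.single i (f i)) =
      (Poly_Mapping.single (\<Sum>i\<in>A. Poly_Mapping.single i (f i)) 1 :: 'a mpoly)" if "finite A" for A f
    using that
  proof induction
    case (insert i A)
    have "(Var i :: 'a mpoly) ^ k = Poly_Mapping.single (Poly_Mapping.single i k) 1" for k
      by (induction k) (simp_all add: Var_def mult_single flip: single_add)
    then show ?case using insert by (simp add: mon_subst_add mon_subst_single mult_single)
  qed simp
  from this[of "Poly_Mapping.keys m" "Poly_Mapping.lookup m"] show ?thesis
    by (simp flip: poly_mapping_sum_singles)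
qed

lemma psubst_Var_id: "psubst Var f = f"
  by (simp add: psubst_alt mon_subst_Var Const_def mult_single flip: poly_mapping_sum_singles)

section \<open>Polynomials in the first \<open>n\<close> variables\<close>

lemma mpolys_Const [simp]: "Const c \<in> mpolys n"
  and mpolys_0 [simp]: "0 \<in> mpolys n"
  and mpolys_1 [simp]: "1 \<in> mpolys n"
  and mpolys_Var: "i < n \<Longrightarrow> Var i \<in> mpolys n"
  by (simp_all add: mpolys_def Const_def Var_def flip: single_one)

lemma mpolys_add: "f \<in> mpolys n \<Longrightarrow> g \<in> mpolys n \<Longrightarrow> f + g \<in> mpolys n"
  using keys_add[of f g] unfolding mpolys_def by blast

lemma mpolys_mult: "f \<in> mpolys n \<Longrightarrow> g \<in> mpolys n \<Longrightarrow> f * g \<in> mpolys n"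
proof -
  assume f: "f \<in> mpolys n" and g: "g \<in> mpolys n"
  have "Poly_Mapping.keys m \<subseteq> {..<n}" if m: "m \<in> Poly_Mapping.keys (f * g)" for m
  proof -
    obtain a b where "m = a + b" "a \<in> Poly_Mapping.keys f" "b \<in> Poly_Mapping.keys g"
      using m keys_mult[of f g] by blast
    then show ?thesis using f g keys_add[of a b] unfolding mpolys_def by blast
  qed
  then show ?thesis unfolding mpolys_def by blast
qed

lemma mpolys_uminus: "f \<in> mpolys n \<Longrightarrow> - f \<in> mpolys n"
  unfolding mpolys_def by (simp add: in_keys_iff)

lemma mpolys_sum: "(\<And>x. x \<in> A \<Longrightarrow> f x \<in> mpolys n) \<Longrightarrow> sum f A \<in> mpolys n"
  by (induction A rule: infinite_finite_induct) (simp_all add: mpolys_add)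

lemma mpolys_prod: "(\<And>x. x \<in> A \<Longrightarrow> f x \<in> mpolys n) \<Longrightarrow> prod f A \<in> mpolys n"
  by (induction A rule: infinite_finite_induct) (simp_all add: mpolys_mult)

lemma mpolys_power: "f \<in> mpolys n \<Longrightarrow> f ^ k \<in> mpolys n"
  by (induction k) (simp_all add: mpolys_mult)

lemma mpolys_psubst:
  assumes "f \<in> mpolys n" "\<And>i. i < n \<Longrightarrow> s i \<in> mpolys k"
  shows "psubst s f \<in> mpolys k"
  unfolding psubst_def
  by (intro mpolys_sum mpolys_mult mpolys_prod mpolys_power mpolys_Const assms)
    (use assms(1) in \<open>auto simp: mpolys_def\<close>)

text \<open>Monomials are built from constants by multiplying with one variable at a time. Thus
  identities between ring homomorphisms need checking on variables only.\<close>

lemma mpolys_induct [consumes 1, case_names Const add Var]: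
  assumes f: "f \<in> mpolys n"
    and C: "\<And>c. P (Const c)"
    and add: "\<And>f g. P f \<Longrightarrow> P g \<Longrightarrow> P (f + g)"
    and Var: "\<And>i f. i < n \<Longrightarrow> P f \<Longrightarrow> P (Var i * f)"
  shows "P f"
proof -
  have zero: "P 0" using C[of 0] by simp
  have pow: "P (Var i ^ k * f)" if "i < n" "P f" for i k f
    using that by (induction k) (simp_all add: Var mult.assoc)
  have "P ((\<Prod>i\<in>A. Var i ^ h i) * Const c)" if "finite A" "A \<subseteq> {..<n}" for A h c
    using that by induction (simp_all add: C pow mult.assoc)
  then have mon: "P (Const c * mon_subst Var m)" if "m \<in> Poly_Mapping.keys f" for c m
    using f that unfolding mpolys_def mon_subst_def by (simp add: mult.commute[of "Const c"])
  have sum: "P (sum g A)" if "\<And>x. x \<in> A \<Longrightarrow> P (g x)" for g and A :: "(nat \<Rightarrow>\<^sub>0 nat) set"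
    using that by (induction A rule: infinite_finite_induct) (simp_all add: zero add)
  have "P (psubst Var f)" unfolding psubst_alt by (intro sum mon)
  then show ?thesis by (simp add: psubst_Var_id)
qed

section \<open>Total degree bounds\<close>

lemma sum_lookup_superset:
  assumes "finite A" "Poly_Mapping.keys m \<subseteq> A"
  shows "(\<Sum>i\<in>Poly_Mapping.keys m. Poly_Mapping.lookup m i) = (\<Sum>i\<in>A. Poly_Mapping.lookup m i)"
  using assms by (intro sum.mono_neutral_left) (auto simp: in_keys_iff)

lemma total_degree_le_mono: "total_degree_le k f \<Longrightarrow> k \<le> l \<Longrightarrow> total_degree_le l f"
  by (auto simp: total_degree_le_def)

lemma total_degree_le_Const [simp]: "total_degree_le k (Const c)"
  by (simp add: total_degree_le_def Const_def)

lemma total_degree_le_1 [simp]: "total_degree_le k 1"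
  using total_degree_le_Const[of k 1] by simp

lemma total_degree_le_0 [simp]: "total_degree_le k 0"
  by (simp add: total_degree_le_def)

lemma total_degree_le_Var: "total_degree_le 1 (Var i)"
  by (simp add: total_degree_le_def Var_def)

lemma total_degree_le_add: "total_degree_le k f \<Longrightarrow> total_degree_le k g \<Longrightarrow> total_degree_le k (f + g)"
  using keys_add[of f g] unfolding total_degree_le_def by blast

lemma total_degree_le_sum:
  "(\<And>x. x \<in> A \<Longrightarrow> total_degree_le k (f x)) \<Longrightarrow> total_degree_le k (sum f A)"
  by (induction A rule: infinite_finite_induct) (simp_all add: total_degree_le_add)

lemma total_degree_le_mult:
  assumes "total_degree_le k f" "total_degree_le l g"
  shows "total_degree_le (k + l) (f * g)"
  unfolding total_degree_le_def
proof
  fix m assume "m \<in> Poly_Mapping.keys (f * g)"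
  then obtain a b where m: "m = a + b" "a \<in> Poly_Mapping.keys f" "b \<in> Poly_Mapping.keys g"
    using keys_mult[of f g] by blast
  let ?A = "Poly_Mapping.keys a \<union> Poly_Mapping.keys b"
  have "Poly_Mapping.keys m \<subseteq> ?A" unfolding m by (rule keys_add)
  then have "(\<Sum>i\<in>Poly_Mapping.keys m. Poly_Mapping.lookup m i) = (\<Sum>i\<in>?A. Poly_Mapping.lookup m i)"
    by (intro sum_lookup_superset) simp_all
  also have "\<dots> = (\<Sum>i\<in>Poly_Mapping.keys a. Poly_Mapping.lookup a i) +
      (\<Sum>i\<in>Poly_Mapping.keys b. Poly_Mapping.lookup b i)"
    using sum_lookup_superset[of ?A a] sum_lookup_superset[of ?A b]
    by (simp add: m(1) lookup_add sum.distrib)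
  also have "\<dots> \<le> k + l"
    using assms m(2,3) by (intro add_mono) (simp_all add: total_degree_le_def)
  finally show "(\<Sum>i\<in>Poly_Mapping.keys m. Poly_Mapping.lookup m i) \<le> k + l" .
qed

lemma total_degree_le_power: "total_degree_le k f \<Longrightarrow> total_degree_le (j * k) (f ^ j)"
  by (induction j) (simp_all add: total_degree_le_mult)

section \<open>The field of invariants\<close>

lemma ring_of_type_algebra_ops:
  fixes x y :: "'a::field"
  defines "R \<equiv> (ring_of_type_algebra :: 'a ring)"
  shows "carrier R = UNIV" "\<one>\<^bsub>R\<^esub> = 1" "\<zero>\<^bsub>R\<^esub> = 0" "x \<oplus>\<^bsub>R\<^esub> y = x + y" "x \<otimes>\<^bsub>R\<^esub> y = x * y"
    and "\<ominus>\<^bsub>R\<^esub> x = - x" "x \<noteq> 0 \<Longrightarrow> inv\<^bsub>R\<^esub> x = inverse x"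
proof -
  interpret field R unfolding R_def by (rule field_from_type_algebra)
  show ops: "carrier R = UNIV" "\<one>\<^bsub>R\<^esub> = 1" "\<zero>\<^bsub>R\<^esub> = 0" "x \<oplus>\<^bsub>R\<^esub> y = x + y" "x \<otimes>\<^bsub>R\<^esub> y = x * y" for x y
    by (simp_all add: R_def ring_of_type_algebra_def)
  show "\<ominus>\<^bsub>R\<^esub> x = - x" by (rule minus_equality) (simp_all add: ops)
  show "x \<noteq> 0 \<Longrightarrow> inv\<^bsub>R\<^esub> x = inverse x" by (rule comm_inv_char) (simp_all add: ops)
qed

lemma generate_field_of_type:
  fixes H :: "'a::field set"
  shows "1 \<in> generate_field ring_of_type_algebra H"
    and "h \<in> H \<Longrightarrow> h \<in> generate_field ring_of_type_algebra H"
    and "x \<in> generate_field ring_of_type_algebra H \<Longrightarrow> - x \<in> generate_field ring_of_type_algebra H"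
    and "x \<in> generate_field ring_of_type_algebra H \<Longrightarrow> inverse x \<in> generate_field ring_of_type_algebra H"
    and "x \<in> generate_field ring_of_type_algebra H \<Longrightarrow> y \<in> generate_field ring_of_type_algebra H \<Longrightarrow>
      x + y \<in> generate_field ring_of_type_algebra H"
    and "x \<in> generate_field ring_of_type_algebra H \<Longrightarrow> y \<in> generate_field ring_of_type_algebra H \<Longrightarrow>
      x * y \<in> generate_field ring_of_type_algebra H"
proof -
  let ?R = "ring_of_type_algebra :: 'a ring"
  note ops = ring_of_type_algebra_ops
  show "1 \<in> generate_field ?R H" "h \<in> H \<Longrightarrow> h \<in> generate_field ?R H"
    using generate_field.one[of ?R H] generate_field.incl[of h H ?R] by (simp_all add: ops)
  show "x \<in> generate_field ?R H \<Longrightarrow> - x \<in> generate_field ?R H"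
    using generate_field.a_inv[of x ?R H] by (simp add: ops)
  \<comment> \<open>For \<open>x = 0\<close> the default value \<open>inverse 0 = 0\<close> is again
    \<open>x\<close>.\<close>
  show "x \<in> generate_field ?R H \<Longrightarrow> inverse x \<in> generate_field ?R H"
    using generate_field.m_inv[of x ?R H] by (cases "x = 0") (simp_all add: ops)
  show "x \<in> generate_field ?R H \<Longrightarrow> y \<in> generate_field ?R H \<Longrightarrow> x + y \<in> generate_field ?R H"
    using generate_field.eng_add[of x ?R H y] by (simp add: ops)
  show "x \<in> generate_field ?R H \<Longrightarrow> y \<in> generate_field ?R H \<Longrightarrow> x * y \<in> generate_field ?R H"
    using generate_field.eng_mult[of x ?R H y] by (simp add: ops)
qed

lemma generate_field_of_type_subset:
  fixes H E :: "'a::field set"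
  assumes "H \<subseteq> E" "1 \<in> E" "\<And>x. x \<in> E \<Longrightarrow> - x \<in> E" "\<And>x. x \<in> E \<Longrightarrow> x \<noteq> 0 \<Longrightarrow> inverse x \<in> E"
    "\<And>x y. x \<in> E \<Longrightarrow> y \<in> E \<Longrightarrow> x + y \<in> E" "\<And>x y. x \<in> E \<Longrightarrow> y \<in> E \<Longrightarrow> x * y \<in> E"
  shows "generate_field ring_of_type_algebra H \<subseteq> E"
proof
  let ?R = "ring_of_type_algebra :: 'a ring"
  note ops = ring_of_type_algebra_ops
  fix x assume "x \<in> generate_field ?R H"
  then show "x \<in> E"
    by induction (use assms in \<open>auto simp: ops\<close>)
qed

section \<open>The group action on polynomials and rational functions\<close>

context finite_dim_rep
begin

lemma rep_entry_one:
  assumes "i < n" "j < n"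
  shows "rep_entry \<one> i j = (if i = j then 1 else 0)"
proof -
  have "representation (b ` {..<n}) (b j) = (\<lambda>v. if v = b j then 1 else 0)"
    using assms by (intro representation_basis independent_Basis) auto
  then show ?thesis
    using assms basis_inj by (auto simp: rep_entry_def rep_one inj_on_def)
qed

lemma rep_entry_mult:
  assumes "g \<in> carrier G" "h \<in> carrier G" "i < n" "k < n"
  shows "rep_entry (g \<otimes> h) i k = (\<Sum>j<n. rep_entry g i j * rep_entry h j k)"
proof -
  interpret lin: Vector_Spaces.linear scale scale "\<rho> g" by (rule rep_linear[OF assms(1)])
  let ?B = "b ` {..<n}"
  have sp: "v \<in> span ?B" for v using span_Basis by simp
  have "\<rho> h (b k) = (\<Sum>j<n. scale (rep_entry h j k) (b j))"
  proof -
    have "\<rho> h (b k) = (\<Sum>v\<in>?B. scale (representation ?B (\<rho> h (b k)) v) v)"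
      by (rule sum_representation_eq[symmetric]) (auto simp: independent_Basis sp)
    then show ?thesis by (simp add: sum.reindex[OF basis_inj] rep_entry_def)
  qed
  then have "\<rho> (g \<otimes> h) (b k) = (\<Sum>j<n. scale (rep_entry h j k) (\<rho> g (b j)))"
    by (simp add: rep_mult assms lin.sum lin.scale)
  then show ?thesis
    by (simp add: rep_entry_def representation_sum[OF independent_Basis] sp
        representation_scale[OF independent_Basis] mult.commute)
qed

lemma act_hom [simp]:
  shows "act g 0 = 0" "act g 1 = 1" "act g (Const c) = Const c"
    and "act g (f + h) = act g f + act g h" "act g (f * h) = act g f * act g h"
    and "act g (f ^ k) = act g f ^ k"
    and "act g (sum u A) = (\<Sum>x\<in>A. act g (u x))" "act g (prod u A) = (\<Prod>x\<in>A. act g (u x))"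
  by (simp_all add: act_def psubst_add psubst_mult psubst_power psubst_sum psubst_prod)

lemma act_uminus [simp]: "act g (- f) = - act g f"
  using act_hom(4)[of g f "- f"] by (simp add: eq_neg_iff_add_eq_0 add.commute)

lemma act_Var: "act g (Var i) = (\<Sum>j<n. Const (rep_entry (inv g) i j) * Var j)"
  by (simp add: act_def)

lemma act_mpolys: "f \<in> mpolys n \<Longrightarrow> act g f \<in> mpolys n"
  unfolding act_def by (erule mpolys_psubst) (auto intro!: mpolys_sum mpolys_mult mpolys_Var)

lemma act_one: "f \<in> mpolys n \<Longrightarrow> act \<one> f = f"
proof (induction rule: mpolys_induct)
  case (Var i f)
  have "act \<one> (Var i) = (\<Sum>j<n. if i = j then Var j else 0)"
    unfolding act_Var by (intro sum.cong) (auto simp: rep_entry_one Var)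
  then show ?case using Var by simp
qed simp_all

text \<open>Substitution composes matrices in reversed order, and so does the inverse in
  \<open>act\<close>; the two reversals cancel, giving a left action.\<close>

lemma act_act:
  assumes "f \<in> mpolys n" "g \<in> carrier G" "h \<in> carrier G"
  shows "act g (act h f) = act (g \<otimes> h) f"
  using assms(1)
proof (induction rule: mpolys_induct)
  case (Var i f)
  have "act g (act h (Var i)) =
      (\<Sum>j<n. \<Sum>k<n. Const (rep_entry (inv h) i j * rep_entry (inv g) j k) * Var k)"
    by (simp add: act_Var sum_distrib_left Const_mult mult.assoc)
  also have "\<dots> = (\<Sum>k<n. Const (\<Sum>j<n. rep_entry (inv h) i j * rep_entry (inv g) j k) * Var k)"
    by (subst sum.swap) (simp add: Const_sum sum_distrib_right)
  also have "\<dots> = act (g \<otimes> h) (Var i)"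
    using assms(2,3) Var(1) by (simp add: act_Var inv_mult_group rep_entry_mult)
  finally show ?case using Var by simp
qed simp_all

lemma act_eq_0_iff:
  assumes "f \<in> mpolys n" "g \<in> carrier G"
  shows "act g f = 0 \<longleftrightarrow> f = 0"
  by (metis act_hom(1) act_act act_one assms inv_closed l_inv)

text \<open>The description in \<open>act_fract\<close> is unique: applying \<open>act g\<close> to
  the cross-multiplied equality of two representatives gives the equality of the images, whose
  denominators stay nonzero.\<close>

lemma act_fract_Fract:
  assumes "f \<in> mpolys n" "h \<in> mpolys n" "h \<noteq> 0" "g \<in> carrier G"
  shows "act_fract g (Fract f h) = Fract (act g f) (act g h)"
  unfolding act_fract_def
proof (rule the_equality, intro ballI impI)
  fix f' h' assume f': "f' \<in> mpolys n" "h' \<in> mpolys n" "h' \<noteq> 0" "Fract f h = Fract f' h'"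
  then have "act g (f * h') = act g (f' * h)" using assms by (simp add: eq_fract)
  then show "Fract (act g f) (act g h) = Fract (act g f') (act g h')"
    using assms f' by (simp add: eq_fract act_eq_0_iff)
qed (use assms in blast)

lemma invariant_rat_funsI:
  assumes "f \<in> mpolys n" "h \<in> mpolys n" "h \<noteq> 0"
    "\<And>g. g \<in> carrier G \<Longrightarrow> act g f * h = f * act g h"
  shows "Fract f h \<in> invariant_rat_funs"
  using assms unfolding invariant_rat_funs_def rat_funs_def
  by (auto simp: act_fract_Fract eq_fract act_eq_0_iff)

lemma invariant_rat_funsE:
  assumes "q \<in> invariant_rat_funs"
  obtains f h where "q = Fract f h" "f \<in> mpolys n" "h \<in> mpolys n" "h \<noteq> 0"
    "\<And>g. g \<in> carrier G \<Longrightarrow> act g f * h = f * act g h"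
proof -
  obtain f h where fh: "q = Fract f h" "f \<in> mpolys n" "h \<in> mpolys n" "h \<noteq> 0"
    and inv: "\<And>g. g \<in> carrier G \<Longrightarrow> act_fract g q = q"
    using assms unfolding invariant_rat_funs_def rat_funs_def by blast
  have "act g f * h = f * act g h" if "g \<in> carrier G" for g
    using inv[OF that] fh that by (simp add: act_fract_Fract eq_fract act_eq_0_iff)
  then show thesis using that fh by blast
qed

text \<open>The easy inclusion: invariant rational functions form a subfield. Each closure property
  is a polynomial identity after cross-multiplication.\<close>

lemma generate_field_subset_invariant_rat_funs:
  assumes "S \<subseteq> invariant_polys"
  shows "generate_field ring_of_type_algebra
    ((\<lambda>c. Fract (Const c) 1) ` UNIV \<union> (\<lambda>f. Fract f 1) ` S) \<subseteq> invariant_rat_funs"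
proof (rule generate_field_of_type_subset)
  show "range (\<lambda>c. Fract (Const c) 1) \<union> (\<lambda>f. Fract f 1) ` S \<subseteq> invariant_rat_funs"
    using assms by (auto simp: invariant_polys_def intro!: invariant_rat_funsI)
  show "1 \<in> invariant_rat_funs"
    unfolding One_fract_def by (intro invariant_rat_funsI) simp_all
next
  fix q assume "q \<in> invariant_rat_funs"
  then obtain f h where fh: "q = Fract f h" "f \<in> mpolys n" "h \<in> mpolys n" "h \<noteq> 0"
    "\<And>g. g \<in> carrier G \<Longrightarrow> act g f * h = f * act g h" by (rule invariant_rat_funsE) blast
  show "- q \<in> invariant_rat_funs"
    unfolding fh(1) minus_fract
    by (intro invariant_rat_funsI) (simp_all add: fh mpolys_uminus)
  assume "q \<noteq> 0"
  then have "f \<noteq> 0" using fh by (auto simp: fract_collapse)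
  then show "inverse q \<in> invariant_rat_funs"
    unfolding fh(1) inverse_fract
    by (intro invariant_rat_funsI) (use fh in \<open>simp_all add: mult.commute\<close>)
next
  fix q r assume "q \<in> invariant_rat_funs" "r \<in> invariant_rat_funs"
  then obtain f h f' h' where fh: "q = Fract f h" "f \<in> mpolys n" "h \<in> mpolys n" "h \<noteq> 0"
    "\<And>g. g \<in> carrier G \<Longrightarrow> act g f * h = f * act g h"
    and fh': "r = Fract f' h'" "f' \<in> mpolys n" "h' \<in> mpolys n" "h' \<noteq> 0"
    "\<And>g. g \<in> carrier G \<Longrightarrow> act g f' * h' = f' * act g h'" by (metis invariant_rat_funsE)
  have "act g (f * h' + f' * h) * (h * h') = (f * h' + f' * h) * act g (h * h')"
    if "g \<in> carrier G" for g
  proof -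
    have "act g (f * h' + f' * h) * (h * h') =
      (act g f * h) * (act g h' * h') + (act g f' * h') * (act g h * h)"
      by (simp add: algebra_simps)
    also have "\<dots> = (f * act g h) * (act g h' * h') + (f' * act g h') * (act g h * h)"
      using fh fh' that by simp
    finally show ?thesis by (simp add: algebra_simps)
  qed
  then show "q + r \<in> invariant_rat_funs"
    unfolding fh(1) fh'(1) add_fract[OF fh(4) fh'(4)]
    by (intro invariant_rat_funsI) (simp_all add: fh fh' mpolys_add mpolys_mult)
  have "act g (f * f') * (h * h') = (f * f') * act g (h * h')" if "g \<in> carrier G" for g
  proof -
    have "act g (f * f') * (h * h') = (act g f * h) * (act g f' * h')"
      by (simp add: algebra_simps)
    also have "\<dots> = (f * act g h) * (f' * act g h')"
      using fh fh' that by simp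
    finally show ?thesis by (simp add: algebra_simps)
  qed
  then show "q * r \<in> invariant_rat_funs"
    unfolding fh(1) fh'(1) mult_fract
    by (intro invariant_rat_funsI) (simp_all add: fh fh' mpolys_mult)
qed

text \<open>Left translation permutes the group; this reindexes orbit sums and orbit
  products.\<close>

lemma bij_betw_mult_left:
  assumes "g \<in> carrier G"
  shows "bij_betw (\<lambda>h. g \<otimes> h) (carrier G) (carrier G)"
  by (rule bij_betw_byWitness[where f' = "\<lambda>h. inv g \<otimes> h"])
    (use assms in \<open>auto simp: m_assoc[symmetric]\<close>)

lemma act_sum_orbit:
  assumes "g \<in> carrier G" "f \<in> mpolys n"
  shows "act g (\<Sum>h\<in>carrier G. act h f) = (\<Sum>h\<in>carrier G. act h f)"
  using sum.reindex_bij_betw[OF bij_betw_mult_left[OF assms(1)], of "\<lambda>h. act h f"] assms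
  by (simp add: act_act)

lemma act_prod_orbit:
  assumes "g \<in> carrier G" "f \<in> mpolys n"
  shows "act g (\<Prod>h\<in>carrier G. act h f) = (\<Prod>h\<in>carrier G. act h f)"
  using prod.reindex_bij_betw[OF bij_betw_mult_left[OF assms(1)], of "\<lambda>h. act h f"] assms
  by (simp add: act_act)

text \<open>Multiplying numerator and denominator by the remaining conjugates of the denominator turns the
  denominator into its norm.\<close>

lemma invariant_rat_funs_quotient:
  assumes "finite (carrier G)" "q \<in> invariant_rat_funs"
  obtains f h where "q = Fract f h" "f \<in> invariant_polys" "h \<in> invariant_polys" "h \<noteq> 0"
proof -
  obtain f h where fh: "q = Fract f h" "f \<in> mpolys n" "h \<in> mpolys n" "h \<noteq> 0"
    "\<And>g. g \<in> carrier G \<Longrightarrow> act g f * h = f * act g h"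
    using invariant_rat_funsE[OF assms(2)] by metis
  define c where "c = (\<Prod>g\<in>carrier G - {\<one>}. act g h)"
  have H: "h * c = (\<Prod>g\<in>carrier G. act g h)"
    unfolding c_def using prod.remove[OF assms(1) one_closed, of "\<lambda>g. act g h"]
    by (simp add: act_one fh)
  have nz: "h * c \<noteq> 0" unfolding H using fh assms(1) by (simp add: act_eq_0_iff)
  have c: "c \<in> mpolys n" unfolding c_def by (intro mpolys_prod act_mpolys fh)
  have inv_hc: "act g (h * c) = h * c" if "g \<in> carrier G" for g
    unfolding H using act_prod_orbit that fh by blast
  \<comment> \<open>After multiplication by \<open>h\<close>, the cross-multiplied invariance moves
    the action from \<open>f\<close> to \<open>h\<close>, where it completes the invariant norm
    \<open>h * c\<close>; then \<open>h\<close> cancels.\<close>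
  have "act g (f * c) = f * c" if g: "g \<in> carrier G" for g
  proof -
    have "h * act g (f * c) = (act g f * h) * act g c" by (simp add: algebra_simps)
    also have "\<dots> = f * act g (h * c)" using fh(5)[OF g] by (simp add: algebra_simps)
    also have "\<dots> = h * (f * c)" unfolding inv_hc[OF g] by (simp add: algebra_simps)
    finally show ?thesis using fh(4) by simp
  qed
  moreover have "q = Fract (f * c) (h * c)"
    using fh nz by (simp add: eq_fract algebra_simps)
  ultimately show thesis
    using that[of "f * c" "h * c"] nz inv_hc fh c by (auto simp: invariant_polys_def mpolys_mult)
qed

end

section \<open>Generating the invariants by short monomials\<close>

lemma Fract_1_hom:
  fixes f g :: "'a::idom"
  shows "Fract (f + g) 1 = Fract f 1 + Fract g 1" "Fract (f * g) 1 = Fract f 1 * Fract g 1"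
    and "Fract (f ^ k) 1 = Fract f 1 ^ k" "Fract f 1 = 0 \<longleftrightarrow> f = 0"
proof -
  show mult: "Fract (f * g) 1 = Fract f 1 * Fract g 1" for f g :: 'a by simp
  show "Fract (f ^ k) 1 = Fract f 1 ^ k"
    by (induction k) (simp_all only: power_0 power_Suc mult One_fract_def)
qed (simp_all add: eq_fract Zero_fract_def)

lemma of_nat_mpoly: "of_nat k = Const (of_nat k)"
  by (induction k) (simp_all add: Const_add)

text \<open>Integer powers are required since \<open>i\<close> and \<open>j\<close> may be
  nonnegative while the coordinates \<open>s\<close>, \<open>t\<close> in the lattice basis are
  not.\<close>

lemma monomial_powi:
  fixes Y Z :: "'a::field" and s t :: int
  assumes "Y \<noteq> 0" "Z \<noteq> 0"
    and "int i = s * int u1 + t * int v1" "int j = s * int u2 + t * int v2"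
  shows "Y ^ i * Z ^ j = (Y ^ u1 * Z ^ u2) powi s * (Y ^ v1 * Z ^ v2) powi t"
proof -
  have "Y ^ i = Y powi (s * int u1 + t * int v1)" "Z ^ j = Z powi (s * int u2 + t * int v2)"
    by (simp_all flip: assms(3,4))
  then show ?thesis
    using assms(1,2) by (simp add: power_int_add power_int_mult_distrib power_int_power mult_ac)
qed

context finite_dim_rep
begin

text \<open>\<open>y k\<close> and \<open>z l\<close> serve as reference forms. Invariants are
  expressed through the \<open>x i\<close>, the two monomials in the reference forms with exponents
  \<open>(u1, u2)\<close> and \<open>(v1, v2)\<close>, and these monomials with one factor
  exchanged; all have degree at most \<open>D\<close>.\<close>

lemma generate_field_eq_invariant_rat_funs:
  fixes \<chi> \<psi> :: "'g \<Rightarrow> 'k" and x y z :: "nat \<Rightarrow> 'k mpoly" and u1 u2 v1 v2 D :: nat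
  assumes fin: "finite (carrier G)" and card: "of_nat (card (carrier G)) \<noteq> (0 :: 'k)"
    and Var: "\<And>i. i < n \<Longrightarrow> Var i = x i + y i + z i"
    and mp: "\<And>i. i < n \<Longrightarrow> x i \<in> mpolys n \<and> y i \<in> mpolys n \<and> z i \<in> mpolys n"
    and deg: "\<And>i. i < n \<Longrightarrow> total_degree_le 1 (x i) \<and> total_degree_le 1 (y i) \<and> total_degree_le 1 (z i)"
    and act_x: "\<And>g i. g \<in> carrier G \<Longrightarrow> i < n \<Longrightarrow> act g (x i) = x i"
    and act_y: "\<And>g i. g \<in> carrier G \<Longrightarrow> i < n \<Longrightarrow> act g (y i) = Const (\<chi> g) * y i"
    and act_z: "\<And>g i. g \<in> carrier G \<Longrightarrow> i < n \<Longrightarrow> act g (z i) = Const (\<psi> g) * z i"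
    and y0: "k < n" "y k \<noteq> 0" and z0: "l < n" "z l \<noteq> 0"
    and D: "u1 + u2 \<le> D" "v1 + v2 \<le> D" "1 \<le> D"
    and u: "\<And>g. g \<in> carrier G \<Longrightarrow> \<chi> g ^ u1 * \<psi> g ^ u2 = 1"
    and v: "\<And>g. g \<in> carrier G \<Longrightarrow> \<chi> g ^ v1 * \<psi> g ^ v2 = 1"
    and nz: "u1 \<noteq> 0 \<or> v1 \<noteq> 0" "u2 \<noteq> 0 \<or> v2 \<noteq> 0"
    and lattice: "\<And>i j. (\<And>g. g \<in> carrier G \<Longrightarrow> \<chi> g ^ i * \<psi> g ^ j = 1) \<Longrightarrow>
      \<exists>s t :: int. int i = s * int u1 + t * int v1 \<and> int j = s * int u2 + t * int v2"
  shows "generate_field ring_of_type_algebra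
    ((\<lambda>c. Fract (Const c) 1) ` UNIV \<union> (\<lambda>f. Fract f 1) ` {f \<in> invariant_polys. total_degree_le D f})
    = invariant_rat_funs"
    (is "?K = _")
proof
  show "?K \<subseteq> invariant_rat_funs" by (rule generate_field_subset_invariant_rat_funs) auto
next
  \<comment> \<open>Products and sums of fractions are to stay field expressions, not to be merged
    into a single \<open>Fract\<close>.\<close>
  note [simp del] = mult_fract add_fract divide_fract
  note K = generate_field_of_type(1,3-6)[where H = "(\<lambda>c. Fract (Const c) 1) ` UNIV \<union>
    (\<lambda>f. Fract f 1) ` {f \<in> invariant_polys. total_degree_le D f}"]
  have K_Const: "Fract (Const c) 1 \<in> ?K" for c
    by (intro generate_field_of_type(2)) blast
  have K_inv: "Fract f 1 \<in> ?K"
    if "f \<in> mpolys n" "\<And>g. g \<in> carrier G \<Longrightarrow> act g f = f" "total_degree_le D f" for f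
    by (intro generate_field_of_type(2)) (use that in \<open>auto simp: invariant_polys_def\<close>)
  have K_div: "q / r \<in> ?K" if "q \<in> ?K" "r \<in> ?K" for q r
    unfolding divide_inverse by (intro K that)
  have K_power: "q ^ m \<in> ?K" if "q \<in> ?K" for q m
    by (induction m) (simp_all add: K that)
  have K_powi: "q powi m \<in> ?K" if "q \<in> ?K" for q m
    by (simp add: power_int_def K K_power that)
  have K_0: "0 \<in> ?K" using K(2)[OF K(1)] K(4)[OF K(1)] by fastforce

  define Y Z where "Y = Fract (y k) 1" and "Z = Fract (z l) 1"
  have YZ: "Y \<noteq> 0" "Z \<noteq> 0" unfolding Y_def Z_def Fract_1_hom using y0 z0 by auto
  have deg_prod: "total_degree_le D (f * y k ^ i * z l ^ j)"
    if "total_degree_le m f" "m + i + j \<le> D" for f m i j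
  proof -
    have "total_degree_le (m + i * 1 + j * 1) (f * y k ^ i * z l ^ j)"
      using that(1) deg y0 z0 by (intro total_degree_le_mult total_degree_le_power) auto
    then show ?thesis by (rule total_degree_le_mono) (use that in simp)
  qed
  have mp_yz: "y k ^ i * z l ^ j \<in> mpolys n" for i j
    using mp y0 z0 by (intro mpolys_mult mpolys_power) auto
  have act_yz: "act g (y k ^ i * z l ^ j) = Const (\<chi> g ^ i * \<psi> g ^ j) * (y k ^ i * z l ^ j)"
    if "g \<in> carrier G" for g i j
    using that y0 z0 by (simp add: act_y act_z power_mult_distrib Const_mult Const_power mult_ac)
  have YZ_K: "Y ^ i * Z ^ j \<in> ?K" if "(i, j) \<in> {(u1, u2), (v1, v2)}" for i j
  proof -
    have "Fract (1 * y k ^ i * z l ^ j) 1 \<in> ?K"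
    proof (rule K_inv)
      show "total_degree_le D (1 * y k ^ i * z l ^ j)"
        by (rule deg_prod[of 0]) (use that D in auto)
    qed (use that mp_yz[of i j] act_yz[of _ i j] u v in auto)
    then show ?thesis by (simp add: Fract_1_hom Y_def Z_def)
  qed

  have x_K: "Fract (x i) 1 \<in> ?K" if "i < n" for i
    using that mp deg act_x D(3) by (intro K_inv) (auto intro: total_degree_le_mono)
  \<comment> \<open>One of the two monomials contains \<open>y k\<close>. Exchanging one such factor
    for \<open>y i\<close> keeps weight and degree bound, and the quotient by the original monomial
    is \<open>y i / y k\<close>. The same works for \<open>z_K\<close>.\<close>
  have y_K: "Fract (y i) 1 / Y \<in> ?K" if i: "i < n" for i
  proof -
    obtain m m' where m: "(Suc m, m') \<in> {(u1, u2), (v1, v2)}"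
      using nz(1) by (metis insertCI not0_implies_Suc)
    have "Fract (y i * y k ^ m * z l ^ m') 1 \<in> ?K"
    proof (rule K_inv)
      show "total_degree_le D (y i * y k ^ m * z l ^ m')"
        by (rule deg_prod[of 1]) (use m D deg i in auto)
      show "y i * y k ^ m * z l ^ m' \<in> mpolys n"
        using mp_yz[of m m'] mp i by (simp add: mpolys_mult mult.assoc)
      fix g assume g: "g \<in> carrier G"
      have "act g (y i * y k ^ m * z l ^ m') =
          Const (\<chi> g ^ Suc m * \<psi> g ^ m') * (y i * y k ^ m * z l ^ m')"
        using g i act_yz[OF g, of m m'] by (simp add: act_y Const_mult mult_ac)
      also have "\<chi> g ^ Suc m * \<psi> g ^ m' = 1" using m u[OF g] v[OF g] by auto
      finally show "act g (y i * y k ^ m * z l ^ m') = y i * y k ^ m * z l ^ m'" by simp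
    qed
    then have "Fract (y i * y k ^ m * z l ^ m') 1 / (Y ^ Suc m * Z ^ m') \<in> ?K"
      using K_div YZ_K[OF m] by blast
    then show ?thesis using YZ by (simp add: Fract_1_hom Y_def Z_def)
  qed
  have z_K: "Fract (z i) 1 / Z \<in> ?K" if i: "i < n" for i
  proof -
    obtain m m' where m: "(m, Suc m') \<in> {(u1, u2), (v1, v2)}"
      using nz(2) by (metis insertCI not0_implies_Suc)
    have "Fract (z i * y k ^ m * z l ^ m') 1 \<in> ?K"
    proof (rule K_inv)
      show "total_degree_le D (z i * y k ^ m * z l ^ m')"
        by (rule deg_prod[of 1]) (use m D deg i in auto)
      show "z i * y k ^ m * z l ^ m' \<in> mpolys n"
        using mp_yz[of m m'] mp i by (simp add: mpolys_mult mult.assoc)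
      fix g assume g: "g \<in> carrier G"
      have "act g (z i * y k ^ m * z l ^ m') =
          Const (\<chi> g ^ m * \<psi> g ^ Suc m') * (z i * y k ^ m * z l ^ m')"
        using g i act_yz[OF g, of m m'] by (simp add: act_z Const_mult mult_ac)
      also have "\<chi> g ^ m * \<psi> g ^ Suc m' = 1" using m u[OF g] v[OF g] by auto
      finally show "act g (z i * y k ^ m * z l ^ m') = z i * y k ^ m * z l ^ m'" by simp
    qed
    then have "Fract (z i * y k ^ m * z l ^ m') 1 / (Y ^ m * Z ^ Suc m') \<in> ?K"
      using K_div YZ_K[OF m] by blast
    then show ?thesis using YZ by (simp add: Fract_1_hom Y_def Z_def)
  qed

  \<comment> \<open>\<open>E f i j\<close>: the form \<open>f\<close> has the weight of the
    reference monomial \<open>Y ^ i * Z ^ j\<close> and differs from it by a factor in the generated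
    field.\<close>
  define E where "E = (\<lambda>f i j. f \<in> mpolys n \<and>
    (\<forall>g\<in>carrier G. act g f = Const (\<chi> g ^ i * \<psi> g ^ j) * f) \<and> Fract f 1 / (Y ^ i * Z ^ j) \<in> ?K)"
  have E_mult: "E (h * f) (i' + i) (j' + j)" if "E h i' j'" "E f i j" for h f i' j' i j
    using that K(5)[of "Fract h 1 / (Y ^ i' * Z ^ j')" "Fract f 1 / (Y ^ i * Z ^ j)"]
    by (simp add: E_def mpolys_mult Fract_1_hom(2) power_add Const_mult mult_ac)
  have E_x: "E (x m * f) i j" if "m < n" "E f i j" for m f i j
    using E_mult[of "x m" 0 0 f i j] that mp act_x x_K by (simp add: E_def)
  have E_y: "E (y m * f) (Suc i) j" if "m < n" "E f i j" for m f i j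
    using E_mult[of "y m" 1 0 f i j] that mp act_y y_K by (simp add: E_def)
  have E_z: "E (z m * f) i (Suc j)" if "m < n" "E f i j" for m f i j
    using E_mult[of "z m" 0 1 f i j] that mp act_z z_K by (simp add: E_def)
  have E_Const: "E (Const c) 0 0" for c
    by (simp add: E_def K_Const)

  \<comment> \<open>Sums of such forms with possibly different weights. Lists make addition a
    concatenation.\<close>
  define S where "S = {f. \<exists>fs. f = sum_list fs \<and> (\<forall>f\<in>set fs. \<exists>i j. E f i j)}"
  have S_add: "f + g \<in> S" if "f \<in> S" "g \<in> S" for f g
  proof -
    obtain fs gs where "f = sum_list fs" "g = sum_list gs"
      "\<forall>f\<in>set fs. \<exists>i j. E f i j" "\<forall>f\<in>set gs. \<exists>i j. E f i j"
      using \<open>f \<in> S\<close> \<open>g \<in> S\<close> unfolding S_def by blast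
    then show ?thesis unfolding S_def by (intro CollectI exI[of _ "fs @ gs"]) auto
  qed
  have E_S: "f \<in> S" if "E f i j" for f i j
    unfolding S_def using that by (intro CollectI exI[of _ "[f]"]) auto
  have S_Var: "Var m * f \<in> S" if m: "m < n" and f: "f \<in> S" for m f
  proof -
    obtain fs where f: "f = sum_list fs" and fs: "\<forall>f\<in>set fs. \<exists>i j. E f i j"
      using f unfolding S_def by blast
    have "Var m * sum_list fs \<in> S" using fs
    proof (induction fs)
      case Nil
      show ?case unfolding S_def by (intro CollectI exI[of _ "[]"]) auto
    next
      case (Cons f fs)
      then obtain i j where f: "E f i j" by auto
      have "Var m * f = x m * f + y m * f + z m * f" by (simp add: Var m algebra_simps)
      then have "Var m * f \<in> S" using E_x[OF m f] E_y[OF m f] E_z[OF m f] by (simp add: E_S S_add)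
      then show ?case using Cons by (simp add: S_add distrib_left)
    qed
    then show ?thesis using f by simp
  qed
  have S_all: "f \<in> S" if "f \<in> mpolys n" for f
    using that by (induction rule: mpolys_induct) (use E_S E_Const S_add S_Var in blast)+

  \<comment> \<open>Averaging acts on a form of a single weight by the factor
    \<open>card (carrier G)\<close> if the weight is trivial and by 0 otherwise. A trivial weight
    puts \<open>(i, j)\<close> in the lattice, so that the reference monomial is in the
    field.\<close>
  have avg_E: "Fract (\<Sum>g\<in>carrier G. act g f) 1 \<in> ?K" if f: "E f i j" for f i j
  proof (cases "\<forall>g\<in>carrier G. \<chi> g ^ i * \<psi> g ^ j = 1")
    case True
    then obtain s t :: int where "int i = s * int u1 + t * int v1" "int j = s * int u2 + t * int v2"
      using lattice by blast
    then have "Y ^ i * Z ^ j = (Y ^ u1 * Z ^ u2) powi s * (Y ^ v1 * Z ^ v2) powi t"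
      using monomial_powi YZ by blast
    then have mon: "Y ^ i * Z ^ j \<in> ?K" using YZ_K by (simp add: K K_powi)
    have quot: "Fract f 1 / (Y ^ i * Z ^ j) \<in> ?K" using f unfolding E_def by blast
    have "Fract f 1 / (Y ^ i * Z ^ j) * (Y ^ i * Z ^ j) \<in> ?K" by (rule K(5)[OF quot mon])
    then have "Fract f 1 \<in> ?K" using YZ by simp
    moreover have "(\<Sum>g\<in>carrier G. act g f) = Const (of_nat (card (carrier G))) * f"
      using f True unfolding E_def by (simp add: of_nat_mpoly)
    ultimately show ?thesis by (simp add: Fract_1_hom K K_Const)
  next
    case False
    then obtain h where h: "h \<in> carrier G" "\<chi> h ^ i * \<psi> h ^ j \<noteq> 1" by blast
    define s where "s = (\<Sum>g\<in>carrier G. act g f)"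
    have "s = (\<Sum>g\<in>carrier G. Const (\<chi> g ^ i * \<psi> g ^ j)) * f"
      using f unfolding s_def E_def by (simp add: sum_distrib_right)
    \<comment> \<open>The orbit sum is both fixed by \<open>h\<close> and scaled by a factor other
      than 1, so it vanishes.\<close>
    then have "act h s = Const (\<chi> h ^ i * \<psi> h ^ j) * s"
      using f h(1) unfolding E_def by (simp add: mult_ac)
    moreover have "act h s = s" using act_sum_orbit h(1) f unfolding s_def E_def by blast
    ultimately have "Const (1 - \<chi> h ^ i * \<psi> h ^ j) * s = 0" by (simp add: Const_diff algebra_simps)
    then have "s = 0" using h(2) by simp
    then show ?thesis using K_0 by (simp add: s_def fract_collapse)
  qed
  have avg_S: "Fract (\<Sum>g\<in>carrier G. act g f) 1 \<in> ?K" if f: "f \<in> S" for f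
  proof -
    obtain fs where f: "f = sum_list fs" and fs: "\<forall>f\<in>set fs. \<exists>i j. E f i j"
      using f unfolding S_def by blast
    have "Fract (\<Sum>g\<in>carrier G. act g (sum_list fs)) 1 \<in> ?K" using fs
    proof (induction fs)
      case Nil
      show ?case using K_0 by (simp add: fract_collapse)
    next
      case (Cons f fs)
      then show ?case using avg_E by (auto simp: sum.distrib Fract_1_hom(1) intro!: K)
    qed
    then show ?thesis using f by simp
  qed
  \<comment> \<open>An invariant is its own average up to the group order, which is invertible in
    the ground field.\<close>
  have inv_K: "Fract f 1 \<in> ?K" if "f \<in> invariant_polys" for f
  proof -
    let ?c = "of_nat (card (carrier G)) :: 'k"
    have "(\<Sum>g\<in>carrier G. act g f) = Const ?c * f"
      using that by (simp add: invariant_polys_def of_nat_mpoly)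
    then have "Fract (Const ?c) 1 * Fract f 1 \<in> ?K"
      using avg_S[OF S_all, of f] that by (simp add: invariant_polys_def Fract_1_hom)
    then have "Fract (Const ?c) 1 * Fract f 1 / Fract (Const ?c) 1 \<in> ?K" by (rule K_div[OF _ K_Const])
    moreover have "Fract (Const ?c) 1 \<noteq> 0" using card by (simp add: Fract_1_hom)
    ultimately show ?thesis by simp
  qed
  show "invariant_rat_funs \<subseteq> ?K"
  proof
    fix q assume "q \<in> invariant_rat_funs"
    then obtain f h where q: "q = Fract f h" "f \<in> invariant_polys" "h \<in> invariant_polys" "h \<noteq> 0"
      using invariant_rat_funs_quotient[OF fin] by metis
    then have "q = Fract f 1 / Fract h 1" by (simp add: divide_fract)
    then show "q \<in> ?K" using K_div inv_K q by simp
  qed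
qed

end

section \<open>Roots of unity\<close>

text \<open>If \<open>k\<close> were coprime to \<open>p\<close>, Bezout's identity would turn
  \<open>z ^ k = 1\<close> and \<open>z ^ p = 1\<close> into \<open>z = 1\<close>.\<close>

lemma root_of_unity_power_eq_1_iff:
  fixes z :: "'a::field"
  assumes "Factorial_Ring.prime p" "z ^ p = 1" "z \<noteq> 1"
  shows "z ^ k = 1 \<longleftrightarrow> p dvd k"
proof
  assume k: "z ^ k = 1"
  show "p dvd k"
  proof (rule ccontr)
    assume "\<not> p dvd k"
    then have "coprime k p" using assms(1) prime_imp_coprime coprime_commute by blast
    moreover have "k \<noteq> 0" using \<open>\<not> p dvd k\<close> by (cases "k = 0") auto
    ultimately obtain x y where "k * x = p * y + 1" using bezout_nat[of k p] by auto
    then have "z ^ (k * x) = z ^ (p * y) * z" by simp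
    then show False using k assms(2,3) by (simp add: power_mult)
  qed
qed (use assms(2) in \<open>auto simp: power_mult elim!: dvdE\<close>)

lemma root_of_unity_power_eq_iff:
  fixes z :: "'a::field"
  assumes "Factorial_Ring.prime p" "z ^ p = 1" "z \<noteq> 1"
  shows "z ^ i = z ^ j \<longleftrightarrow> int p dvd int j - int i"
proof -
  have z: "z \<noteq> 0" using assms by (metis prime_gt_0_nat power_0_left not_gr_zero zero_neq_one)
  have le: "z ^ i = z ^ j \<longleftrightarrow> int p dvd int j - int i" if "i \<le> j" for i j
  proof -
    have "z ^ j = z ^ i * z ^ (j - i)" using that by (simp flip: power_add)
    then have "z ^ i = z ^ j \<longleftrightarrow> z ^ (j - i) = 1" using z by auto
    also have "\<dots> \<longleftrightarrow> int p dvd int (j - i)" using root_of_unity_power_eq_1_iff[OF assms] by simp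
    finally show ?thesis using that by (simp add: of_nat_diff)
  qed
  show ?thesis using le[of i j] le[of j i] by (metis dvd_diff_commute nle_le)
qed

text \<open>The first \<open>p\<close> powers of \<open>w\<close> are distinct roots, and there are
  only \<open>p\<close> roots in all.\<close>

lemma root_of_unity_is_power:
  fixes z w :: "'a::field"
  assumes p: "Factorial_Ring.prime p" and card: "card {z :: 'a. z ^ p = 1} = p"
    and w: "w ^ p = 1" "w \<noteq> 1" and z: "z ^ p = 1"
  obtains e where "e < p" "z = w ^ e"
proof -
  let ?U = "{z :: 'a. z ^ p = 1}"
  have fin: "finite ?U" using card p by (metis card.infinite not_prime_0)
  have "inj_on (\<lambda>e. w ^ e) {..<p}"
  proof (rule inj_onI)
    fix i j assume ij: "i \<in> {..<p}" "j \<in> {..<p}" "w ^ i = w ^ j"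
    then have "int p dvd int j - int i" using root_of_unity_power_eq_iff[OF p w] by simp
    moreover have "\<bar>int j - int i\<bar> < int p" using ij by auto
    ultimately show "i = j" using zdvd_not_zless[of "\<bar>int j - int i\<bar>" "int p"] by fastforce
  qed
  then have "card ((\<lambda>e. w ^ e) ` {..<p}) = card ?U" by (simp add: card card_image)
  moreover have "(\<lambda>e. w ^ e) ` {..<p} \<subseteq> ?U"
    using w(1) by (auto simp: power_mult[symmetric] mult.commute[of _ p]) (simp add: power_mult)
  ultimately have "(\<lambda>e. w ^ e) ` {..<p} = ?U" using fin by (simp add: card_subset_eq)
  then show thesis using z that by blast
qed

text \<open>Orthogonality of the characters of the cyclic group, stated with all \<open>p\<close>-th
  roots of unity as evaluation points.\<close>

lemma discrete_fourier_inversion: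
  fixes a :: "nat \<Rightarrow> 'a::field"
  assumes p: "Factorial_Ring.prime p" and card: "card {z :: 'a. z ^ p = 1} = p" and m: "m < p"
  shows "of_nat p * a m = (\<Sum>z | z ^ p = 1. z ^ m * (\<Sum>l<p. inverse z ^ l * a l))"
proof -
  let ?U = "{z :: 'a. z ^ p = 1}"
  have fin: "finite ?U" using card p by (metis card.infinite not_prime_0)
  have p0: "0 < p" using p by (rule prime_gt_0_nat)
  have U0: "z \<noteq> 0" if "z \<in> ?U" for z using that p0 by (auto simp: power_0_left)
  have "\<not> ?U \<subseteq> {1}"
    using card_mono[of "{1}" ?U] card prime_gt_1_nat[OF p] by auto
  then obtain w :: 'a where w: "w ^ p = 1" "w \<noteq> 1" by blast
  \<comment> \<open>Multiplication by \<open>w\<close> permutes the roots, hence fixes the sum over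
    them, yet multiplies it by \<open>w ^ m * inverse w ^ l\<close>. For \<open>l \<noteq> m\<close>
    this factor is not 1 and the sum is 0.\<close>
  have "bij_betw ((*) w) ?U ?U"
    by (rule bij_betw_byWitness[where f' = "(*) (inverse w)"])
      (use w U0[of w] in \<open>auto simp: power_mult_distrib power_inverse\<close>)
  note shift = sum.reindex_bij_betw[OF this, symmetric]
  have orth: "(\<Sum>z\<in>?U. z ^ m * inverse z ^ l) = (if l = m then of_nat p else 0)" if l: "l < p" for l
  proof (cases "l = m")
    case True
    have "(\<Sum>z\<in>?U. z ^ m * inverse z ^ l) = (\<Sum>z\<in>?U. 1)"
      using U0 True by (intro sum.cong) (auto simp: power_inverse)
    then show ?thesis using True card by simp
  next
    case False
    let ?S = "\<Sum>z\<in>?U. z ^ m * inverse z ^ l"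
    have "?S = w ^ m * inverse w ^ l * ?S"
      by (subst shift) (simp add: power_mult_distrib sum_distrib_left mult_ac)
    moreover have "w ^ m \<noteq> w ^ l"
    proof
      assume "w ^ m = w ^ l"
      then have "int p dvd \<bar>int l - int m\<bar>" using root_of_unity_power_eq_iff[OF p w] by simp
      moreover have "\<bar>int l - int m\<bar> < int p" "0 < \<bar>int l - int m\<bar>" using l m False by auto
      ultimately show False using zdvd_not_zless by blast
    qed
    then have "w ^ m * inverse w ^ l \<noteq> 1"
      using U0[of w] w(1) by (simp add: power_inverse field_simps)
    moreover have "s = 0" if "s = c * s" "c \<noteq> 1" for s c :: 'a using that by simp
    ultimately have "?S = 0" by blast
    then show ?thesis using False by simp
  qed
  have "(\<Sum>z\<in>?U. z ^ m * (\<Sum>l<p. inverse z ^ l * a l)) =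
      (\<Sum>l<p. (\<Sum>z\<in>?U. z ^ m * inverse z ^ l) * a l)"
    by (simp add: sum_distrib_left sum_distrib_right sum.swap[of _ ?U] mult.assoc)
  also have "\<dots> = (\<Sum>l<p. if l = m then of_nat p * a l else 0)"
    by (intro sum.cong) (auto simp: orth)
  also have "\<dots> = of_nat p * a m" using m by simp
  finally show ?thesis by simp
qed

text \<open>Shifting by one moves the first term to the end, where periodicity identifies
  it.\<close>

lemma sum_periodic_shift:
  fixes f :: "nat \<Rightarrow> 'a::ab_group_add"
  assumes "\<And>l. f (l + p) = f l"
  shows "(\<Sum>l<p. f (l + m)) = (\<Sum>l<p. f l)"
proof (induction m)
  case (Suc m)
  have "f m + (\<Sum>l<p. f (Suc l + m)) = (\<Sum>l<Suc p. f (l + m))"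
    by (simp add: sum.lessThan_Suc_shift del: sum.lessThan_Suc)
  also have "\<dots> = f m + (\<Sum>l<p. f (l + m))" using assms[of m] by (simp add: add.commute)
  finally show ?case using Suc by simp
qed simp

lemma ring_hom_of_type:
  fixes \<iota> :: "'a::field \<Rightarrow> 'e::field"
  assumes "\<iota> \<in> ring_hom ring_of_type_algebra ring_of_type_algebra"
  shows "\<iota> (x + y) = \<iota> x + \<iota> y" "\<iota> (x * y) = \<iota> x * \<iota> y" "\<iota> 1 = 1" "\<iota> 0 = 0" "\<iota> (- x) = - \<iota> x"
    and "\<iota> (x - y) = \<iota> x - \<iota> y" "\<iota> (x ^ k) = \<iota> x ^ k" "\<iota> (of_nat k) = of_nat k"
    and "\<iota> (sum f S) = (\<Sum>s\<in>S. \<iota> (f s))" "\<iota> x = 0 \<longleftrightarrow> x = 0" "\<iota> (inverse x) = inverse (\<iota> x)"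
    and "\<iota> x = \<iota> y \<longleftrightarrow> x = y"
proof -
  show add: "\<iota> (x + y) = \<iota> x + \<iota> y" and mult: "\<iota> (x * y) = \<iota> x * \<iota> y" for x y
    using ring_hom_add[OF assms, of x y] ring_hom_mult[OF assms, of x y]
    by (simp_all add: ring_of_type_algebra_ops)
  show one: "\<iota> 1 = 1" using ring_hom_one[OF assms] by (simp add: ring_of_type_algebra_ops)
  show zero: "\<iota> 0 = 0" by (metis add add.right_neutral add_left_cancel)
  show minus: "\<iota> (- x) = - \<iota> x" for x
    using add[of x "- x"] zero by (simp add: eq_neg_iff_add_eq_0 add.commute)
  show diff: "\<iota> (x - y) = \<iota> x - \<iota> y" for x y using add[of x "- y"] minus by simp
  show "\<iota> (x ^ k) = \<iota> x ^ k" by (induction k) (simp_all add: one mult)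
  show "\<iota> (of_nat k) = of_nat k" by (induction k) (simp_all add: zero one add)
  show "\<iota> (sum f S) = (\<Sum>s\<in>S. \<iota> (f s))"
    by (induction S rule: infinite_finite_induct) (simp_all add: zero add)
  have inv: "\<iota> x * \<iota> (inverse x) = 1" if "x \<noteq> 0" for x using that by (simp add: one flip: mult)
  show eq0: "\<iota> x = 0 \<longleftrightarrow> x = 0" for x using inv[of x] zero by (cases "x = 0") auto
  show "\<iota> (inverse x) = inverse (\<iota> x)"
    using inv[of x] zero by (cases "x = 0") (simp_all add: inverse_unique)
  show "\<iota> x = \<iota> y \<longleftrightarrow> x = y" using eq0[of "x - y"] diff by simp
qed

section \<open>Eigenforms over the ground field\<close>

locale two_character_rep = finite_dim_rep "integer_mod_group p" scale \<rho> b n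
  for p n :: nat
    and scale :: "'k::field \<Rightarrow> 'v::ab_group_add \<Rightarrow> 'v"
    and \<rho> :: "int \<Rightarrow> 'v \<Rightarrow> 'v"
    and b :: "nat \<Rightarrow> 'v" +
  fixes \<iota> :: "'k \<Rightarrow> 'e::field"
    and \<chi>\<^sub>1 \<chi>\<^sub>2 :: "int \<Rightarrow> 'e"
  assumes prime_p: "Factorial_Ring.prime p"
    and char_ne: "CHAR('k) \<noteq> p"
    and \<iota>: "\<iota> \<in> ring_hom ring_of_type_algebra ring_of_type_algebra"
    and card_roots: "card {z :: 'e. z ^ p = 1} = p"
    and chars: "nontrivial_characters_occurring \<iota> = {\<chi>\<^sub>1, \<chi>\<^sub>2}"
    and chars_ne: "\<chi>\<^sub>1 \<noteq> \<chi>\<^sub>2"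
    and chars_not_inverse: "\<chi>\<^sub>2 \<noteq> (\<lambda>g\<in>carrier (integer_mod_group p). inverse (\<chi>\<^sub>1 g))"
begin

lemmas \<iota>_hom = ring_hom_of_type[OF \<iota>]

lemma p_pos: "0 < p" using prime_p by (rule prime_gt_0_nat)

lemma of_nat_p_neq_0: "of_nat p \<noteq> (0 :: 'k)" "of_nat p \<noteq> (0 :: 'e)"
proof -
  show k: "of_nat p \<noteq> (0 :: 'k)"
  proof
    assume "of_nat p = (0 :: 'k)"
    then have "CHAR('k) dvd p" by (simp add: of_nat_eq_0_iff_char_dvd)
    then show False using char_ne prime_p by (auto simp: prime_nat_iff)
  qed
  show "of_nat p \<noteq> (0 :: 'e)" using \<iota>_hom(8)[of p] \<iota>_hom(10)[of "of_nat p"] k by simp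
qed

lemma carrier_eq: "carrier (integer_mod_group p) = {0..<int p}"
  using p_pos by (simp add: carrier_integer_mod_group)

text \<open>The matrix of the \<open>m\<close>-th power of the generator 1. Indexing by all natural
  numbers turns the group law into addition of exponents, with period \<open>p\<close>.\<close>

definition mat :: "nat \<Rightarrow> nat \<Rightarrow> nat \<Rightarrow> 'k" where
  "mat m i j = rep_entry (int m mod int p) i j"

lemma mat_0: "i < n \<Longrightarrow> j < n \<Longrightarrow> mat 0 i j = (if i = j then 1 else 0)"
  using rep_entry_one[of i j] by (simp add: mat_def)

lemma mat_add:
  assumes "i < n" "k < n"
  shows "mat (l + m) i k = (\<Sum>j<n. mat l i j * mat m j k)"
  using rep_entry_mult[of "int l mod int p" "int m mod int p" i k] assms p_pos
  by (simp add: mat_def carrier_eq mod_simps)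

lemma mat_period: "mat (m + p) = mat m"
  by (simp add: mat_def fun_eq_iff)

lemma rep_entry_eq_mat: "g \<in> carrier (integer_mod_group p) \<Longrightarrow> rep_entry g = mat (nat g)"
  by (simp add: mat_def fun_eq_iff carrier_eq)

definition eigvec :: "'e \<Rightarrow> (nat \<Rightarrow> 'e) \<Rightarrow> bool" where
  "eigvec z w \<longleftrightarrow> (\<forall>i<n. (\<Sum>j<n. \<iota> (mat 1 i j) * w j) = z * w i)"

lemma eigvec_mat:
  assumes "eigvec z w" "i < n"
  shows "(\<Sum>j<n. \<iota> (mat m i j) * w j) = z ^ m * w i"
  using assms(2)
proof (induction m arbitrary: i)
  case 0
  have "(\<Sum>j<n. \<iota> (mat 0 i j) * w j) = (\<Sum>j<n. if i = j then w j else 0)"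
    using 0 by (intro sum.cong) (auto simp: mat_0 \<iota>_hom)
  then show ?case using 0 by simp
next
  case (Suc m)
  have "(\<Sum>k<n. \<iota> (mat (Suc m) i k) * w k) = (\<Sum>k<n. \<Sum>j<n. \<iota> (mat m i j) * (\<iota> (mat 1 j k) * w k))"
    using mat_add[of i _ m 1] Suc.prems by (simp add: \<iota>_hom sum_distrib_right mult.assoc)
  also have "\<dots> = (\<Sum>j<n. \<iota> (mat m i j) * (\<Sum>k<n. \<iota> (mat 1 j k) * w k))"
    by (subst sum.swap) (simp add: sum_distrib_left)
  also have "\<dots> = (\<Sum>j<n. \<iota> (mat m i j) * (z * w j))"
    using assms(1) by (intro sum.cong) (auto simp: eigvec_def)
  also have "\<dots> = z * (\<Sum>j<n. \<iota> (mat m i j) * w j)" by (simp add: sum_distrib_left mult_ac)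
  finally show ?case using Suc by simp
qed

text \<open>The group is cyclic, so an eigenvector of the generator is one for every group element,
  with powers of the eigenvalue.\<close>

lemma character_occurring_of_eigvec:
  assumes "z ^ p = 1" "eigvec z w" "i < n" "w i \<noteq> 0"
  shows "(\<lambda>g\<in>carrier (integer_mod_group p). z ^ nat g) \<in> characters_occurring \<iota>"
proof -
  have z: "z \<noteq> 0" using assms(1) p_pos by (auto simp: power_0_left)
  have z_mod: "z ^ nat (m mod int p) = z ^ nat m" if "0 \<le> m" for m
  proof -
    have "z ^ nat m = z ^ (p * (nat m div p) + nat m mod p)" by simp
    also have "\<dots> = z ^ (nat m mod p)" unfolding power_add power_mult assms(1) by simp
    finally show ?thesis using that by (simp add: nat_mod_distrib)
  qed
  have "z ^ nat ((g + h) mod int p) = z ^ nat g * z ^ nat h" if "0 \<le> g" "0 \<le> h" for g h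
    using that by (simp add: z_mod nat_add_distrib power_add)
  then have "(\<lambda>g\<in>carrier (integer_mod_group p). z ^ nat g) \<in>
      hom (integer_mod_group p) (mult_of (ring_of_type_algebra :: 'e ring))"
    using z p_pos by (auto simp: hom_def carrier_eq ring_of_type_algebra_ops)
  moreover have "(\<Sum>j<n. \<iota> (rep_entry g i j) * w j) = z ^ nat g * w i"
    if "g \<in> carrier (integer_mod_group p)" "i < n" for g i
    using that eigvec_mat[OF assms(2)] by (simp add: rep_entry_eq_mat)
  ultimately show ?thesis
    unfolding characters_occurring_def using assms(3,4) by (auto intro!: exI[of _ w])
qed

lemma eigvec_of_character_occurring:
  assumes "\<chi> \<in> characters_occurring \<iota>"
  obtains w i where "\<chi> 1 ^ p = 1" "\<chi> = (\<lambda>g\<in>carrier (integer_mod_group p). \<chi> 1 ^ nat g)"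
    "eigvec (\<chi> 1) w" "i < n" "w i \<noteq> 0"
proof -
  let ?G = "carrier (integer_mod_group p)"
  have hom: "\<chi> \<in> hom (integer_mod_group p) (mult_of (ring_of_type_algebra :: 'e ring))"
    and ext: "\<chi> \<in> extensional ?G"
    using assms unfolding characters_occurring_def by auto
  obtain w i where w: "i < n" "w i \<noteq> 0"
    "\<And>g i. g \<in> ?G \<Longrightarrow> i < n \<Longrightarrow> (\<Sum>j<n. \<iota> (rep_entry g i j) * w j) = \<chi> g * w i"
    using assms unfolding characters_occurring_def by blast
  have p1: "1 < p" using prime_p by (rule prime_gt_1_nat)
  have mult: "\<chi> ((g + h) mod int p) = \<chi> g * \<chi> h" if "g \<in> ?G" "h \<in> ?G" for g h
    using hom_mult[OF hom that] by (simp add: ring_of_type_algebra_ops)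
  \<comment> \<open>Values are units, so \<open>\<chi> 0\<close> is a nonzero idempotent, that is
    1.\<close>
  have "\<chi> 0 \<noteq> 0"
    using hom p_pos by (auto simp: hom_def carrier_eq ring_of_type_algebra_ops dest!: funcset_mem[where x = 0])
  moreover have "\<chi> 0 = \<chi> 0 * \<chi> 0" using mult[of 0 0] by simp
  ultimately have one: "\<chi> 0 = 1" by simp
  have pow: "\<chi> (int m mod int p) = \<chi> 1 ^ m" for m
  proof (induction m)
    case (Suc m)
    have "\<chi> (int (Suc m) mod int p) = \<chi> ((1 + int m mod int p) mod int p)" by (simp add: mod_simps)
    also have "\<dots> = \<chi> 1 * \<chi> (int m mod int p)" using p1 by (intro mult) (auto simp: carrier_eq)
    finally show ?case using Suc by simp
  qed (simp add: one)
  have "\<chi> g = \<chi> 1 ^ nat g" if "g \<in> ?G" for g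
    using pow[of "nat g"] that by (simp add: carrier_eq)
  then have "\<chi> = (\<lambda>g\<in>?G. \<chi> 1 ^ nat g)" using ext by (auto simp: extensional_def restrict_def)
  moreover have "eigvec (\<chi> 1) w" unfolding eigvec_def
    using w(3)[of 1] p1 by (simp add: rep_entry_eq_mat carrier_eq)
  ultimately show thesis using that[of w i] pow[of p] one w by simp
qed

definition "\<zeta>\<^sub>1 = \<chi>\<^sub>1 1"
definition "\<zeta>\<^sub>2 = \<chi>\<^sub>2 1"

lemma \<chi>_eq:
  "\<chi>\<^sub>1 = (\<lambda>g\<in>carrier (integer_mod_group p). \<zeta>\<^sub>1 ^ nat g)"
  "\<chi>\<^sub>2 = (\<lambda>g\<in>carrier (integer_mod_group p). \<zeta>\<^sub>2 ^ nat g)"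
  and \<zeta>_root: "\<zeta>\<^sub>1 ^ p = 1" "\<zeta>\<^sub>2 ^ p = 1"
  and \<zeta>_eigvec: "\<exists>w i. eigvec \<zeta>\<^sub>1 w \<and> i < n \<and> w i \<noteq> 0" "\<exists>w i. eigvec \<zeta>\<^sub>2 w \<and> i < n \<and> w i \<noteq> 0"
proof -
  have "\<chi>\<^sub>1 \<in> characters_occurring \<iota>" "\<chi>\<^sub>2 \<in> characters_occurring \<iota>"
    using chars unfolding nontrivial_characters_occurring_def by auto
  note * = this[THEN eigvec_of_character_occurring]
  show "\<chi>\<^sub>1 = (\<lambda>g\<in>carrier (integer_mod_group p). \<zeta>\<^sub>1 ^ nat g)"
    "\<chi>\<^sub>2 = (\<lambda>g\<in>carrier (integer_mod_group p). \<zeta>\<^sub>2 ^ nat g)" "\<zeta>\<^sub>1 ^ p = 1" "\<zeta>\<^sub>2 ^ p = 1"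
    unfolding \<zeta>\<^sub>1_def \<zeta>\<^sub>2_def by (rule *; blast)+
  show "\<exists>w i. eigvec \<zeta>\<^sub>1 w \<and> i < n \<and> w i \<noteq> 0" "\<exists>w i. eigvec \<zeta>\<^sub>2 w \<and> i < n \<and> w i \<noteq> 0"
    unfolding \<zeta>\<^sub>1_def \<zeta>\<^sub>2_def by (rule *; blast)+
qed

lemma \<zeta>_ne: "\<zeta>\<^sub>1 \<noteq> 1" "\<zeta>\<^sub>2 \<noteq> 1" "\<zeta>\<^sub>1 \<noteq> \<zeta>\<^sub>2" "\<zeta>\<^sub>1 * \<zeta>\<^sub>2 \<noteq> 1"
proof -
  have "\<chi>\<^sub>1 \<noteq> (\<lambda>g\<in>carrier (integer_mod_group p). 1)" "\<chi>\<^sub>2 \<noteq> (\<lambda>g\<in>carrier (integer_mod_group p). 1)"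
    using chars unfolding nontrivial_characters_occurring_def by auto
  then show "\<zeta>\<^sub>1 \<noteq> 1" "\<zeta>\<^sub>2 \<noteq> 1" using \<chi>_eq by auto
  show "\<zeta>\<^sub>1 \<noteq> \<zeta>\<^sub>2" using chars_ne \<chi>_eq by auto
  show "\<zeta>\<^sub>1 * \<zeta>\<^sub>2 \<noteq> 1"
  proof
    assume "\<zeta>\<^sub>1 * \<zeta>\<^sub>2 = 1"
    then have inv: "\<zeta>\<^sub>2 = inverse \<zeta>\<^sub>1" by (simp add: inverse_unique)
    have "\<chi>\<^sub>2 g = inverse (\<chi>\<^sub>1 g)" if "g \<in> carrier (integer_mod_group p)" for g
      using that by (subst (1) \<chi>_eq(1), subst \<chi>_eq(2)) (simp add: inv power_inverse)
    moreover have "\<chi>\<^sub>2 g = undefined" if "g \<notin> carrier (integer_mod_group p)" for g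
      using that by (subst \<chi>_eq(2)) simp
    ultimately have "\<chi>\<^sub>2 = (\<lambda>g\<in>carrier (integer_mod_group p). inverse (\<chi>\<^sub>1 g))"
      by (intro ext) (simp add: restrict_def)
    then show False using chars_not_inverse by blast
  qed
qed

lemma eigvec_root:
  assumes "z ^ p = 1" "eigvec z w" "i < n" "w i \<noteq> 0"
  shows "z \<in> {1, \<zeta>\<^sub>1, \<zeta>\<^sub>2}"
proof -
  define \<chi> where "\<chi> = (\<lambda>g\<in>carrier (integer_mod_group p). z ^ nat g)"
  have "\<chi> \<in> characters_occurring \<iota>"
    unfolding \<chi>_def by (rule character_occurring_of_eigvec[OF assms])
  then have "\<chi> \<in> {\<chi>\<^sub>1, \<chi>\<^sub>2, \<lambda>g\<in>carrier (integer_mod_group p). 1}"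
    using chars unfolding nontrivial_characters_occurring_def by blast
  moreover have "\<chi> 1 = z" using prime_gt_1_nat[OF prime_p] by (simp add: \<chi>_def carrier_eq)
  moreover have "(\<lambda>g\<in>carrier (integer_mod_group p). 1) (1 :: int) = (1 :: 'e)"
    using prime_gt_1_nat[OF prime_p] by (simp add: carrier_eq)
  ultimately show ?thesis unfolding \<zeta>\<^sub>1_def \<zeta>\<^sub>2_def by auto
qed

end

lemma sum_Const_Var_eq_0:
  assumes "(\<Sum>j<n. Const (c j) * Var j) = 0" "k < n"
  shows "c k = 0"
proof -
  have "Poly_Mapping.lookup (Const (c j) * Var j) (Poly_Mapping.single k 1) = (if j = k then c j else 0)"
    for j
  proof -
    have "Poly_Mapping.single j (1 :: nat) = Poly_Mapping.single k 1 \<longleftrightarrow> j = k"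
      by (metis lookup_single_eq lookup_single_not_eq zero_neq_one)
    then show ?thesis by (simp add: Const_def Var_def mult_single lookup_single when_def)
  qed
  then have "Poly_Mapping.lookup (\<Sum>j<n. Const (c j) * Var j) (Poly_Mapping.single k 1) = c k"
    using assms(2) by (simp add: lookup_sum)
  then show ?thesis using assms(1) by simp
qed

section \<open>Fourier components of the matrix powers\<close>

context two_character_rep
begin

text \<open>For a \<open>p\<close>-th root of unity \<open>z\<close> this is \<open>p\<close> times
  the projection onto the \<open>z\<close>-eigenspace of the generator.\<close>

definition coef :: "'e \<Rightarrow> nat \<Rightarrow> nat \<Rightarrow> 'e" where
  "coef z i j = (\<Sum>l<p. inverse z ^ l * \<iota> (mat l i j))"

lemma coef_eigvec:
  assumes z: "z ^ p = 1" and k: "k < n"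
  shows "eigvec z (\<lambda>j. coef z j k)"
  unfolding eigvec_def
proof (intro allI impI)
  fix i assume i: "i < n"
  have z0: "z \<noteq> 0" using z p_pos by (auto simp: power_0_left)
  have "(\<Sum>j<n. \<iota> (mat 1 i j) * coef z j k) = (\<Sum>l<p. inverse z ^ l * (\<Sum>j<n. \<iota> (mat 1 i j) * \<iota> (mat l j k)))"
    unfolding coef_def sum_distrib_left by (subst sum.swap) (simp add: mult_ac)
  also have "\<dots> = (\<Sum>l<p. inverse z ^ l * \<iota> (mat (l + 1) i k))"
    using mat_add[OF i k, of 1] by (simp add: \<iota>_hom)
  also have "\<dots> = z * (\<Sum>l<p. inverse z ^ (l + 1) * \<iota> (mat (l + 1) i k))"
    unfolding sum_distrib_left using z0 by (intro sum.cong) auto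
  also have "(\<Sum>l<p. inverse z ^ (l + 1) * \<iota> (mat (l + 1) i k)) = coef z i k"
    unfolding coef_def by (rule sum_periodic_shift) (simp add: mat_period power_add power_inverse z)
  finally show "(\<Sum>j<n. \<iota> (mat 1 i j) * coef z j k) = z * coef z i k" .
qed

text \<open>In Fourier inversion only three roots survive: the columns of \<open>coef z\<close> are
  eigenvectors for \<open>z\<close>, hence zero unless \<open>z\<close> is one of the
  eigenvalues.\<close>

lemma \<iota>_mat_eq:
  assumes "m < p" "i < n" "j < n"
  shows "of_nat p * \<iota> (mat m i j) = coef 1 i j + \<zeta>\<^sub>1 ^ m * coef \<zeta>\<^sub>1 i j + \<zeta>\<^sub>2 ^ m * coef \<zeta>\<^sub>2 i j"
proof -
  have fin: "finite {z :: 'e. z ^ p = 1}" using card_roots p_pos by (metis card.infinite less_irrefl)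
  have "of_nat p * \<iota> (mat m i j) = (\<Sum>z | z ^ p = 1. z ^ m * coef z i j)"
    unfolding coef_def by (rule discrete_fourier_inversion[OF prime_p card_roots assms(1)])
  also have "\<dots> = (\<Sum>z\<in>{1, \<zeta>\<^sub>1, \<zeta>\<^sub>2}. z ^ m * coef z i j)"
    using fin \<zeta>_root eigvec_root[OF _ coef_eigvec] assms by (intro sum.mono_neutral_right) auto
  finally show ?thesis using \<zeta>_ne by (simp add: add.assoc)
qed

lemma coef_mult_eigvec:
  assumes "z ^ p = 1" "eigvec z w" "i < n"
  shows "(\<Sum>j<n. coef z i j * w j) = of_nat p * w i"
proof -
  have z0: "z \<noteq> 0" using assms(1) p_pos by (auto simp: power_0_left)
  have "(\<Sum>j<n. coef z i j * w j) = (\<Sum>l<p. inverse z ^ l * (\<Sum>j<n. \<iota> (mat l i j) * w j))"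
    unfolding coef_def sum_distrib_left sum_distrib_right by (subst sum.swap) (simp add: mult_ac)
  also have "\<dots> = (\<Sum>l<p. w i)"
    using eigvec_mat[OF assms(2,3)] z0 by (intro sum.cong) (auto simp: power_inverse)
  finally show ?thesis by simp
qed

text \<open>The exponent 0 would make the first character trivial, 1 would make the characters
  inverse, and \<open>p - 1\<close> would make them equal.\<close>

lemma character_exponent:
  obtains e where "2 \<le> e" "e + 2 \<le> p" "\<zeta>\<^sub>1 * \<zeta>\<^sub>2 ^ e = 1"
proof -
  have "inverse \<zeta>\<^sub>1 ^ p = 1" by (simp add: power_inverse \<zeta>_root)
  then obtain e where e: "e < p" "inverse \<zeta>\<^sub>1 = \<zeta>\<^sub>2 ^ e"
    using root_of_unity_is_power[OF prime_p card_roots \<zeta>_root(2) \<zeta>_ne(2)] by metis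
  have nz: "\<zeta>\<^sub>1 \<noteq> 0" "\<zeta>\<^sub>2 \<noteq> 0" using \<zeta>_root p_pos by (auto simp: power_0_left)
  have prod: "\<zeta>\<^sub>1 * \<zeta>\<^sub>2 ^ e = 1" using nz by (simp flip: e(2))
  have "e \<noteq> 0" using prod \<zeta>_ne by (cases "e = 0") auto
  moreover have "e \<noteq> 1" using prod \<zeta>_ne by (cases "e = 1") auto
  moreover have "Suc e \<noteq> p"
  proof
    assume "Suc e = p"
    then have "\<zeta>\<^sub>2 * \<zeta>\<^sub>2 ^ e = \<zeta>\<^sub>1 * \<zeta>\<^sub>2 ^ e" using \<zeta>_root(2) prod by (metis power_Suc)
    then show False using nz \<zeta>_ne by simp
  qed
  ultimately show thesis using that[of e] e(1) prod by simp
qed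

lemma p_ge_5: "5 \<le> p"
proof -
  obtain e where "2 \<le> e" "e + 2 \<le> p" using character_exponent by blast
  moreover have "p \<noteq> 4"
  proof
    assume "p = 4"
    then have "2 dvd p" by simp
    then have "2 = (1 :: nat) \<or> 2 = p" using prime_p unfolding prime_nat_iff by blast
    then show False using \<open>p = 4\<close> by simp
  qed
  ultimately show ?thesis by simp
qed

text \<open>The sum and the product of the two nontrivial eigenvalues are the coefficients of a linear
  recurrence satisfied by the matrix powers, whose entries lie in the ground field, and they are
  determined by it; so they lie in the ground field as well.\<close>

lemma prod_in_ground_field: "\<exists>q. \<zeta>\<^sub>1 * \<zeta>\<^sub>2 = \<iota> q"
proof -
  \<comment> \<open>Differences remove the component of eigenvalue 1, which leaves a recurrence of
    order two with the sum and product of the other eigenvalues as coefficients.\<close>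
  define D where "D = (\<lambda>m i j. mat (Suc m) i j - mat m i j)"
  have rec: "\<iota> (D 2 i j) = (\<zeta>\<^sub>1 + \<zeta>\<^sub>2) * \<iota> (D 1 i j) - \<zeta>\<^sub>1 * \<zeta>\<^sub>2 * \<iota> (D 0 i j)"
    if ij: "i < n" "j < n" for i j
  proof -
    have D: "of_nat p * \<iota> (D m i j) =
        \<zeta>\<^sub>1 ^ m * (\<zeta>\<^sub>1 - 1) * coef \<zeta>\<^sub>1 i j + \<zeta>\<^sub>2 ^ m * (\<zeta>\<^sub>2 - 1) * coef \<zeta>\<^sub>2 i j" if "m \<le> 2" for m
      using \<iota>_mat_eq[OF _ ij, of m] \<iota>_mat_eq[OF _ ij, of "Suc m"] that p_ge_5
      by (simp add: D_def \<iota>_hom algebra_simps)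
    have "of_nat p * \<iota> (D 2 i j) =
        (\<zeta>\<^sub>1 + \<zeta>\<^sub>2) * (of_nat p * \<iota> (D 1 i j)) - \<zeta>\<^sub>1 * \<zeta>\<^sub>2 * (of_nat p * \<iota> (D 0 i j))"
      by (simp add: D power2_eq_square algebra_simps)
    also have "\<dots> = of_nat p * ((\<zeta>\<^sub>1 + \<zeta>\<^sub>2) * \<iota> (D 1 i j) - \<zeta>\<^sub>1 * \<zeta>\<^sub>2 * \<iota> (D 0 i j))"
      by (simp add: algebra_simps)
    finally show ?thesis using of_nat_p_neq_0(2) by simp
  qed
  have eig_D: "(\<Sum>j<n. \<iota> (D m i j) * w j) = z ^ m * (z - 1) * w i" if "eigvec z w" "i < n" for z w m i
    using eigvec_mat[OF that, of m] eigvec_mat[OF that, of "Suc m"]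
    by (simp add: D_def \<iota>_hom left_diff_distrib sum_subtractf algebra_simps)
  \<comment> \<open>Some minor is nonzero, so two entries determine the recurrence. Otherwise
    \<open>D 0\<close> and \<open>D 1\<close> are proportional; testing on eigenvectors gives both
    \<open>\<zeta>\<^sub>1\<close> and \<open>\<zeta>\<^sub>2\<close> as the ratio, so
    \<open>D 0 = 0\<close>, although it scales a nonzero vector by
    \<open>\<zeta>\<^sub>1 - 1\<close>.\<close>
  have "\<exists>i<n. \<exists>j<n. \<exists>k<n. \<exists>l<n. D 0 i j * D 1 k l - D 0 k l * D 1 i j \<noteq> 0"
  proof (rule ccontr)
    assume contr: "\<not> ?thesis"
    have *: "\<iota> (D 1 k l) = z * \<iota> (D 0 k l)"
      if "eigvec z w" "i < n" "w i \<noteq> 0" "z \<noteq> 1" "k < n" "l < n" for z w i k l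
    proof -
      have "(\<Sum>j<n. \<iota> (D 0 i j) * w j) * \<iota> (D 1 k l) = (\<Sum>j<n. \<iota> (D 0 i j * D 1 k l) * w j)"
        unfolding sum_distrib_right by (simp add: \<iota>_hom mult_ac)
      also have "\<dots> = (\<Sum>j<n. \<iota> (D 0 k l * D 1 i j) * w j)"
        using contr that by (intro sum.cong) auto
      also have "\<dots> = \<iota> (D 0 k l) * (\<Sum>j<n. \<iota> (D 1 i j) * w j)"
        unfolding sum_distrib_left by (simp add: \<iota>_hom mult_ac)
      finally have "((z - 1) * w i) * \<iota> (D 1 k l) = ((z - 1) * w i) * (z * \<iota> (D 0 k l))"
        using eig_D[OF that(1,2)] by (simp add: mult_ac)
      then show ?thesis using that by simp
    qed
    obtain w i w' i' where w: "eigvec \<zeta>\<^sub>1 w" "i < n" "w i \<noteq> 0"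
      and w': "eigvec \<zeta>\<^sub>2 w'" "i' < n" "w' i' \<noteq> 0" using \<zeta>_eigvec by blast
    have "\<iota> (D 0 k l) = 0" if "k < n" "l < n" for k l
      using *[OF w \<zeta>_ne(1) that] *[OF w' \<zeta>_ne(2) that] \<zeta>_ne(3) by simp
    then have "(\<Sum>j<n. \<iota> (D 0 i j) * w j) = 0" using w(2) by simp
    then show False using eig_D[OF w(1,2), of 0] w(3) \<zeta>_ne(1) by simp
  qed
  then obtain i j k l where ij: "i < n" "j < n" "k < n" "l < n"
    and M: "D 0 i j * D 1 k l - D 0 k l * D 1 i j \<noteq> 0" (is "?M \<noteq> 0") by blast
  \<comment> \<open>Cramer's rule: this combination of the two instances of the recurrence
    eliminates the sum of the eigenvalues.\<close>
  have "\<iota> (D 2 k l * D 1 i j - D 2 i j * D 1 k l) = \<zeta>\<^sub>1 * \<zeta>\<^sub>2 * \<iota> ?M"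
    unfolding \<iota>_hom(2,6) rec[OF ij(1,2)] rec[OF ij(3,4)] by (simp add: algebra_simps)
  then have "\<zeta>\<^sub>1 * \<zeta>\<^sub>2 = \<iota> ((D 2 k l * D 1 i j - D 2 i j * D 1 k l) * inverse ?M)"
    using M \<iota>_hom(10)[of ?M] by (simp only: \<iota>_hom(2,11)) simp
  then show ?thesis by blast
qed

text \<open>The product is a \<open>p\<close>-th root of unity other than 1, so all others are
  powers of it.\<close>

lemma roots_in_ground_field: "\<exists>\<omega>. \<zeta>\<^sub>1 = \<iota> \<omega>" "\<exists>\<omega>. \<zeta>\<^sub>2 = \<iota> \<omega>"
proof -
  obtain q where q: "\<zeta>\<^sub>1 * \<zeta>\<^sub>2 = \<iota> q" using prod_in_ground_field by blast
  have "(\<zeta>\<^sub>1 * \<zeta>\<^sub>2) ^ p = 1" by (simp add: power_mult_distrib \<zeta>_root)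
  then have "\<exists>\<omega>. z = \<iota> \<omega>" if "z ^ p = 1" for z
    using root_of_unity_is_power[OF prime_p card_roots _ \<zeta>_ne(4) that] q \<iota>_hom(7) by metis
  then show "\<exists>\<omega>. \<zeta>\<^sub>1 = \<iota> \<omega>" "\<exists>\<omega>. \<zeta>\<^sub>2 = \<iota> \<omega>" using \<zeta>_root by blast+
qed

section \<open>Eigenprojections and eigenforms with ground field coefficients\<close>

definition proj :: "'k \<Rightarrow> nat \<Rightarrow> nat \<Rightarrow> 'k" where
  "proj z i j = inverse (of_nat p) * (\<Sum>l<p. inverse z ^ l * mat l i j)"

lemma \<iota>_proj: "\<iota> (proj z i j) = inverse (of_nat p) * coef (\<iota> z) i j"
  by (simp add: proj_def coef_def \<iota>_hom)

lemma proj_mat: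
  assumes z: "z ^ p = 1" and "i < n" "k < n"
  shows "(\<Sum>j<n. proj z i j * mat m j k) = z ^ m * proj z i k"
proof -
  have z0: "z \<noteq> 0" using z p_pos by (auto simp: power_0_left)
  have "(\<Sum>j<n. proj z i j * mat m j k) =
      inverse (of_nat p) * (\<Sum>l<p. inverse z ^ l * (\<Sum>j<n. mat l i j * mat m j k))"
    unfolding proj_def sum_distrib_left sum_distrib_right by (subst sum.swap) (simp add: mult_ac)
  also have "(\<Sum>l<p. inverse z ^ l * (\<Sum>j<n. mat l i j * mat m j k)) = (\<Sum>l<p. inverse z ^ l * mat (l + m) i k)"
    using mat_add[OF assms(2,3)] by simp
  also have "\<dots> = z ^ m * (\<Sum>l<p. inverse z ^ (l + m) * mat (l + m) i k)"
    unfolding sum_distrib_left using z0 by (intro sum.cong) (auto simp: power_add power_inverse)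
  also have "(\<Sum>l<p. inverse z ^ (l + m) * mat (l + m) i k) = (\<Sum>l<p. inverse z ^ l * mat l i k)"
    by (rule sum_periodic_shift) (simp add: mat_period power_add power_inverse z)
  finally show ?thesis by (simp add: proj_def)
qed

text \<open>The \<open>i\<close>-th coordinate function composed with the projection onto the
  \<open>z\<close>-eigenspace.\<close>

definition eigform :: "'k \<Rightarrow> nat \<Rightarrow> 'k mpoly" where
  "eigform z i = (\<Sum>j<n. Const (proj z i j) * Var j)"

lemma eigform_mpolys: "eigform z i \<in> mpolys n"
  unfolding eigform_def by (intro mpolys_sum mpolys_mult) (auto simp: mpolys_Var)

lemma eigform_degree: "total_degree_le 1 (eigform z i)"
  unfolding eigform_def
  by (rule total_degree_le_sum) (use total_degree_le_mult[OF total_degree_le_Const[of 0] total_degree_le_Var] in auto)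

text \<open>The exponent belongs to \<open>- g\<close> because a group element acts on functions
  through its inverse.\<close>

lemma act_eigform:
  assumes z: "z ^ p = 1" and i: "i < n" and g: "g \<in> carrier (integer_mod_group p)"
  shows "act g (eigform z i) = Const (z ^ nat (- g mod int p)) * eigform z i"
proof -
  let ?m = "nat (- g mod int p)"
  have r: "rep_entry (inv\<^bsub>integer_mod_group p\<^esub> g) = mat ?m"
    using g p_pos by (simp add: rep_entry_eq_mat carrier_eq)
  have "act g (eigform z i) = (\<Sum>k<n. Const (\<Sum>j<n. proj z i j * mat ?m j k) * Var k)"
    unfolding eigform_def
    by (simp add: act_Var r sum_distrib_left sum_distrib_right Const_sum Const_mult mult.assoc)
      (rule sum.swap)
  also have "\<dots> = Const (z ^ ?m) * eigform z i"
    using proj_mat[OF z i] by (simp add: eigform_def sum_distrib_left Const_mult mult.assoc)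
  finally show ?thesis .
qed

text \<open>The projection fixes an eigenvector \<open>w\<close>, so the form at an index with
  \<open>w i \<noteq> 0\<close> cannot have all coefficients zero.\<close>

lemma eigform_nonzero:
  assumes "\<iota> z ^ p = 1" "\<exists>w i. eigvec (\<iota> z) w \<and> i < n \<and> w i \<noteq> 0"
  shows "\<exists>k<n. eigform z k \<noteq> 0"
proof -
  obtain w i where w: "eigvec (\<iota> z) w" "i < n" "w i \<noteq> 0" using assms(2) by blast
  have "eigform z i \<noteq> 0"
  proof
    assume "eigform z i = 0"
    then have "proj z i j = 0" if "j < n" for j using sum_Const_Var_eq_0 that unfolding eigform_def by blast
    then have "coef (\<iota> z) i j = 0" if "j < n" for j
      using \<iota>_proj[of z i j] of_nat_p_neq_0(2) that by (simp add: \<iota>_hom)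
    then have "of_nat p * w i = 0" using coef_mult_eigvec[OF assms(1) w(1,2)] by simp
    then show False using w(3) of_nat_p_neq_0(2) by simp
  qed
  then show ?thesis using w(2) by blast
qed

lemma beta_field_le: "beta_field \<le> (p + 3) div 2"
proof -
  obtain \<omega>\<^sub>1 \<omega>\<^sub>2 where \<omega>: "\<zeta>\<^sub>1 = \<iota> \<omega>\<^sub>1" "\<zeta>\<^sub>2 = \<iota> \<omega>\<^sub>2" using roots_in_ground_field by blast
  have root: "\<omega>\<^sub>1 ^ p = 1" "\<omega>\<^sub>2 ^ p = 1" and ne: "\<omega>\<^sub>2 \<noteq> 1"
    using \<zeta>_root \<zeta>_ne unfolding \<omega> by (metis \<iota>_hom(3,7,12))+
  obtain e where e: "2 \<le> e" "e + 2 \<le> p" "\<zeta>\<^sub>1 * \<zeta>\<^sub>2 ^ e = 1" using character_exponent by blast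
  have \<omega>e: "\<omega>\<^sub>1 * \<omega>\<^sub>2 ^ e = 1"
    using e(3) unfolding \<omega> by (metis \<iota>_hom(2,3,7,12))
  \<comment> \<open>As \<open>\<omega>\<^sub>1\<close> is the inverse of
    \<open>\<omega>\<^sub>2 ^ e\<close>, the condition compares two powers of
    \<open>\<omega>\<^sub>2\<close>.\<close>
  have lattice_iff: "\<omega>\<^sub>1 ^ i * \<omega>\<^sub>2 ^ j = 1 \<longleftrightarrow> int p dvd int j - int e * int i" for i j
  proof -
    have "\<omega>\<^sub>2 ^ (e * i) * (\<omega>\<^sub>1 ^ i * \<omega>\<^sub>2 ^ j) = (\<omega>\<^sub>1 * \<omega>\<^sub>2 ^ e) ^ i * \<omega>\<^sub>2 ^ j"
      by (simp add: power_mult_distrib power_mult mult_ac)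
    then have "\<omega>\<^sub>2 ^ (e * i) * (\<omega>\<^sub>1 ^ i * \<omega>\<^sub>2 ^ j) = \<omega>\<^sub>2 ^ j" by (simp add: \<omega>e)
    moreover have "\<omega>\<^sub>2 ^ (e * i) \<noteq> 0" using root(2) p_pos by (auto simp: power_0_left)
    ultimately have "\<omega>\<^sub>1 ^ i * \<omega>\<^sub>2 ^ j = 1 \<longleftrightarrow> \<omega>\<^sub>2 ^ (e * i) = \<omega>\<^sub>2 ^ j"
      by (metis mult.right_neutral mult_left_cancel)
    then show ?thesis using root_of_unity_power_eq_iff[OF prime_p root(2) ne] by simp
  qed
  have odd: "odd p" using prime_p p_ge_5 prime_odd_nat by simp
  obtain a b c d :: nat where deg: "a + b \<le> (p + 3) div 2" "c + d \<le> (p + 3) div 2"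
    and dvd: "int p dvd int b - int e * int a" "int p dvd int d - int e * int c"
    and det: "\<bar>int a * int d - int b * int c\<bar> = int p"
    using small_lattice_basis[OF odd e(1,2)] by metis
  \<comment> \<open>The weights of the eigenforms are the characters of the dual, inverse to those
    occurring in the representation; they cut out the same lattice.\<close>
  define \<chi> \<psi> where "\<chi> = (\<lambda>g. \<omega>\<^sub>1 ^ nat (- g mod int p))" and "\<psi> = (\<lambda>g. \<omega>\<^sub>2 ^ nat (- g mod int p))"
  have pow: "\<chi> g ^ i * \<psi> g ^ j = (\<omega>\<^sub>1 ^ i * \<omega>\<^sub>2 ^ j) ^ nat (- g mod int p)" for g i j
    by (simp add: \<chi>_def \<psi>_def power_mult_distrib mult.commute flip: power_mult)
  let ?K = "\<lambda>D. generate_field ring_of_type_algebra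
    ((\<lambda>c. Fract (Const c) 1) ` UNIV \<union> (\<lambda>f. Fract f 1) ` {f \<in> invariant_polys. total_degree_le D f})"
  obtain k where k: "k < n" "eigform \<omega>\<^sub>1 k \<noteq> 0"
    using eigform_nonzero[of \<omega>\<^sub>1] \<zeta>_root \<zeta>_eigvec unfolding \<omega> by blast
  obtain l where l: "l < n" "eigform \<omega>\<^sub>2 l \<noteq> 0"
    using eigform_nonzero[of \<omega>\<^sub>2] \<zeta>_root \<zeta>_eigvec unfolding \<omega> by blast
  have "?K ((p + 3) div 2) = invariant_rat_funs"
  proof (rule generate_field_eq_invariant_rat_funs[where x = "eigform 1" and y = "eigform \<omega>\<^sub>1"
      and z = "eigform \<omega>\<^sub>2" and \<chi> = \<chi> and \<psi> = \<psi>, OF _ _ _ _ _ _ _ _ k l deg])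
    show "finite (carrier (integer_mod_group p))" "of_nat (card (carrier (integer_mod_group p))) \<noteq> (0 :: 'k)"
      using of_nat_p_neq_0 by (simp_all add: carrier_eq)
    show "Var i = eigform 1 i + eigform \<omega>\<^sub>1 i + eigform \<omega>\<^sub>2 i" if i: "i < n" for i
    proof -
      \<comment> \<open>The three projections add up to the identity: this is Fourier inversion at
        exponent 0.\<close>
      have "proj 1 i j + proj \<omega>\<^sub>1 i j + proj \<omega>\<^sub>2 i j = (if i = j then 1 else 0)" if j: "j < n" for j
      proof -
        have "\<iota> (proj 1 i j + proj \<omega>\<^sub>1 i j + proj \<omega>\<^sub>2 i j) = inverse (of_nat p) * (of_nat p * \<iota> (mat 0 i j))"
          unfolding \<iota>_mat_eq[OF p_pos i j] \<omega> by (simp add: \<iota>_hom(1,3) \<iota>_proj algebra_simps)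
        then have "\<iota> (proj 1 i j + proj \<omega>\<^sub>1 i j + proj \<omega>\<^sub>2 i j) = \<iota> (mat 0 i j)" using of_nat_p_neq_0(2) by simp
        then show ?thesis using mat_0[OF i j] by (simp only: \<iota>_hom(12))
      qed
      then have "(\<Sum>j<n. Const (proj 1 i j + proj \<omega>\<^sub>1 i j + proj \<omega>\<^sub>2 i j) * Var j) =
          (\<Sum>j<n. if i = j then Var j else 0)" by (intro sum.cong) auto
      then show ?thesis using i by (simp add: eigform_def Const_add distrib_right sum.distrib)
    qed
    show "act g (eigform 1 i) = eigform 1 i" if "g \<in> carrier (integer_mod_group p)" "i < n" for g i
      using act_eigform[of 1 i g] that by simp
    show "act g (eigform \<omega>\<^sub>1 i) = Const (\<chi> g) * eigform \<omega>\<^sub>1 i"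
      "act g (eigform \<omega>\<^sub>2 i) = Const (\<psi> g) * eigform \<omega>\<^sub>2 i"
      if "g \<in> carrier (integer_mod_group p)" "i < n" for g i
      unfolding \<chi>_def \<psi>_def using act_eigform root that by blast+
    show "\<chi> g ^ a * \<psi> g ^ b = 1" "\<chi> g ^ c * \<psi> g ^ d = 1" for g
      using dvd lattice_iff[of a b] lattice_iff[of c d] by (simp_all add: pow)
    \<comment> \<open>Two vanishing first entries would make the determinant 0; likewise for the
      second entries.\<close>
    show "a \<noteq> 0 \<or> c \<noteq> 0" using det p_pos by (intro disjCI notI) simp
    show "b \<noteq> 0 \<or> d \<noteq> 0" using det p_pos by (intro disjCI notI) simp
    fix i j assume ij: "\<And>g. g \<in> carrier (integer_mod_group p) \<Longrightarrow> \<chi> g ^ i * \<psi> g ^ j = 1"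
    \<comment> \<open>The element \<open>p - 1\<close>, the inverse of the generator, has exponent
      1, so its weight is \<open>\<omega>\<^sub>1 ^ i * \<omega>\<^sub>2 ^ j\<close> itself.\<close>
    have "- (int p - 1) mod int p = (1 + (- 1) * int p) mod int p" by simp
    also have "\<dots> = 1" using p_ge_5 by (subst mod_mult_self1) simp
    finally have "- (int p - 1) mod int p = 1" .
    then have "\<omega>\<^sub>1 ^ i * \<omega>\<^sub>2 ^ j = 1" using ij[of "int p - 1"] p_pos by (simp add: pow carrier_eq)
    then have "int p dvd int j - int e * int i" using lattice_iff by blast
    then show "\<exists>s t :: int. int i = s * int a + t * int c \<and> int j = s * int b + t * int d"
      using lattice_coordinates[OF p_pos det dvd] by metis
  qed (use eigform_mpolys eigform_degree in auto)
  then show ?thesis unfolding beta_field_def by (rule Least_le)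
qed

end

theorem proposition4p4:
  fixes p n :: nat
    and scale :: "'k::field \<Rightarrow> 'v::ab_group_add \<Rightarrow> 'v"
    and \<rho> :: "int \<Rightarrow> 'v \<Rightarrow> 'v"
    and b :: "nat \<Rightarrow> 'v"
    and \<iota> :: "'k \<Rightarrow> 'e::field"
    and \<chi>\<^sub>1 \<chi>\<^sub>2 :: "int \<Rightarrow> 'e"
  assumes "Factorial_Ring.prime p"
    and "CHAR('k) \<noteq> p"
    and "finite_dim_rep (integer_mod_group p) scale \<rho> b n"
    and "finite_dim_rep.faithful (integer_mod_group p) \<rho>"
    and "\<iota> \<in> ring_hom ring_of_type_algebra ring_of_type_algebra"
    and "card {z :: 'e. z ^ p = 1} = p"
    and "finite_dim_rep.nontrivial_characters_occurring (integer_mod_group p) scale \<rho> b n \<iota>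
           = {\<chi>\<^sub>1, \<chi>\<^sub>2}"
    and "\<chi>\<^sub>1 \<noteq> \<chi>\<^sub>2"
    and "\<chi>\<^sub>2 \<noteq> (\<lambda>g\<in>carrier (integer_mod_group p). inverse (\<chi>\<^sub>1 g))"
  shows "real (finite_dim_rep.beta_field (integer_mod_group p) scale \<rho> b n) \<le> (real p + 3) / 2"
proof -
  interpret two_character_rep p n scale \<rho> b \<iota> \<chi>\<^sub>1 \<chi>\<^sub>2
    using assms by (intro two_character_rep.intro two_character_rep_axioms.intro)
  have "2 * beta_field \<le> p + 3" using beta_field_le by simp
  then show ?thesis by simp
qed

end
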